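(* Let $K$ be an infinite pseudocompact Tychonoff space. The following conditions are equivalent: (i) the Banach space $C(K)$ is strongly Gelfand--Phillips; (ii) the Banach space $C(K)$ is isomorphic to a subspace of $c_0$; (iii) $K$ is compact and countable, and the Banach space $C(K)$ is isomorphic to $c_0$; (iv) the space $K$ is compact, countable and has finite scattered height.
   Context: $\mathbb{F}$ is the field of real or complex numbers (fixed), $\omega$ is the set of nonnegative integers, and $c_0$ is the Banach space (over $\mathbb{F}$, with sup-norm) of null sequences. A Tychonoff space $K$ is pseudocompact if each real-valued continuous function on $K$ is bounded; then $C(K)$, the space of $\mathbb{F}$-valued continuous functions on $K$, is a Banach space with the norm $\|f\|:=\sup_{x\in K}|f(x)|$. Isomorphic means linearly homeomorphic. For a Banach space $E$ with dual $E'$, a bounded set $B\subseteq E$ and $\chi\in E'$, put $\|\chi\|_B:=\sup\{|\chi(x)|:x\in B\}$. A subset of $E$ is precompact if its closure in $E$ is compact. $E$ is strongly Gelfand--Phillips if there is a weak$^\ast$ null sequence $(\chi_n)_{n\in\omega}$ in $E'$ such that $\|\chi_n\|_B\not\to 0$ for every bounded non-precompact set $B\subseteq E$. For a topological space $X$, let $X^{(0)}:=X$, let $X^{(1)}$ be the space of non-isolated points of $X$, and for a non-zero ordinal $\alpha$ let $X^{(\alpha)}:=\bigcap_{\beta<\alpha}(X^{(\beta)})^{(1)}$. $X$ is scattered if each nonempty subspace of $X$ has an isolated point; equivalently, $X^{(\alpha)}=\emptyset$ for some ordinal $\alpha$. The smallest ordinal $\alpha$ with $X^{(\alpha)}=\emptyset$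 is the scattered height of $X$; thus $X$ has finite scattered height iff $X^{(n)}=\emptyset$ for some $n\in\omega$. *)

theory Defs
  imports "HOL-Analysis.Analysis"
begin

definition tychonoff_space :: "'a topology \<Rightarrow> bool" where
  "tychonoff_space X \<longleftrightarrow> completely_regular_space X \<and> Hausdorff_space X"

definition pseudocompact_space :: "'a topology \<Rightarrow> bool" where
  "pseudocompact_space X \<longleftrightarrow>
     (\<forall>f :: 'a \<Rightarrow> real. continuous_map X euclideanreal f \<longrightarrow> bounded (f ` topspace X))"


text \<open>
  The type \<^typ>\<open>'a \<Rightarrow>\<^sub>C 'f\<close> consists of the bounded continuous functions with the supremum norm.
  Over a pseudocompact space every continuous function into the real or complex field is bounded
  (see \<open>pseudocompact_imp_bounded\<close> below), so this type is the Banach space of all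
  continuous functions.  The library only provides the real vector space structure; the
  following operation is the multiplication by scalars from \<^typ>\<open>'f\<close>.
\<close>

definition bcf_scale ::
    "'f::real_normed_field \<Rightarrow> ('a::topological_space \<Rightarrow>\<^sub>C 'f) \<Rightarrow> ('a \<Rightarrow>\<^sub>C 'f)" where
  "bcf_scale c f = Bcontfun (\<lambda>x. c * apply_bcontfun f x)"

lemma apply_bcf_scale [simp]: "apply_bcontfun (bcf_scale c f) x = c * apply_bcontfun f x"
proof -
  have "bounded ((\<lambda>y. c * y) ` range (apply_bcontfun f))"
    by (intro bounded_linear_image bounded_linear_mult_right bounded_apply_bcontfun)
  then have "(\<lambda>x. c * apply_bcontfun f x) \<in> bcontfun"
    by (auto simp: bcontfun_def image_image intro!: continuous_intros)
  then show ?thesis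
    by (simp add: bcf_scale_def Bcontfun_inverse)
qed

lemma vector_space_bcf_scale: "vector_space bcf_scale"
  by unfold_locales (auto intro!: bcontfun_eqI simp: algebra_simps)

lemma bcf_scale_of_real: "bcf_scale (of_real r) f = r *\<^sub>R f"
  by (rule bcontfun_eqI) (simp add: scaleR_conv_of_real)

lemma pseudocompact_imp_bounded:
  fixes f :: "'a::topological_space \<Rightarrow> 'f::real_normed_vector"
  assumes "pseudocompact_space (euclidean :: 'a topology)" and "continuous_on UNIV f"
  shows "f \<in> bcontfun"
proof -
  have "continuous_map euclidean euclideanreal (\<lambda>x. norm (f x))"
    using assms(2) by (simp add: continuous_on_norm)
  then have "bounded (range (\<lambda>x. norm (f x)))"
    using assms(1) unfolding pseudocompact_space_def by fastforce
  then show ?thesis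
    using assms(2) by (auto simp: bcontfun_def bounded_iff)
qed

lemma complete_bcontfun:
  "complete (UNIV :: ('a::topological_space \<Rightarrow>\<^sub>C 'b::complete_space) set)"
proof (rule completeI)
  fix f :: "nat \<Rightarrow> 'a \<Rightarrow>\<^sub>C 'b"
  assume "Cauchy f"
  then have "uniformly_Cauchy_on UNIV (\<lambda>n. apply_bcontfun (f n))"
    unfolding Cauchy_def uniformly_Cauchy_on_def
    by (metis dist_fun_lt_imp_dist_val_lt)
  then obtain g where "uniform_limit UNIV (\<lambda>n. apply_bcontfun (f n)) g sequentially"
    using Cauchy_uniformly_convergent uniformly_convergent_on_def by blast
  then show "\<exists>l\<in>UNIV. f \<longlonglongrightarrow> l"
    by (metis UNIV_I sequentially_bot uniform_limit_bcontfunE)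
qed

text \<open>
  Null sequences; every sequence is continuous for the discrete topology of \<^typ>\<open>nat\<close>.
\<close>

definition c_null :: "(nat \<Rightarrow>\<^sub>C 'f::real_normed_field) set" where
  "c_null = {x. apply_bcontfun x \<longlonglongrightarrow> 0}"

lemma subspace_c_null: "module.subspace bcf_scale (c_null :: (nat \<Rightarrow>\<^sub>C 'f::real_normed_field) set)"
proof -
  interpret vector_space "bcf_scale :: 'f \<Rightarrow> (nat \<Rightarrow>\<^sub>C 'f) \<Rightarrow> _"
    by (rule vector_space_bcf_scale)
  have scale_eq: "apply_bcontfun (bcf_scale c x) = (\<lambda>n. c * apply_bcontfun x n)"
    for c :: 'f and x :: "nat \<Rightarrow>\<^sub>C 'f"
    by (rule ext) simp
  show ?thesis
    unfolding subspace_def c_null_def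
    by (auto simp: plus_bcontfun.rep_eq zero_bcontfun.rep_eq scale_eq
             intro: tendsto_add_zero tendsto_mult_right_zero)
qed


text \<open>
  For normed spaces over the field \<^typ>\<open>'f\<close> the scalar multiplication is passed explicitly, as
  in the library locale \<^locale>\<open>vector_space\<close>.
\<close>

definition dual_space ::
    "('f::real_normed_field \<Rightarrow> 'e::real_normed_vector \<Rightarrow> 'e) \<Rightarrow> ('e \<Rightarrow> 'f) set" where
  "dual_space smul = {\<phi>. Vector_Spaces.linear smul (*) \<phi> \<and> continuous_on UNIV \<phi>}"

definition norm_on :: "'e set \<Rightarrow> ('e \<Rightarrow> 'f::real_normed_field) \<Rightarrow> real" where
  "norm_on B \<phi> = (SUP x\<in>B. norm (\<phi> x))"

definition precompact :: "'e::topological_space set \<Rightarrow> bool" where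
  "precompact B \<longleftrightarrow> compact (closure B)"

definition weak_star_null ::
    "('f::real_normed_field \<Rightarrow> 'e::real_normed_vector \<Rightarrow> 'e) \<Rightarrow> (nat \<Rightarrow> 'e \<Rightarrow> 'f) \<Rightarrow> bool" where
  "weak_star_null smul \<phi> \<longleftrightarrow> (\<forall>n. \<phi> n \<in> dual_space smul) \<and> (\<forall>x. (\<lambda>n. \<phi> n x) \<longlonglongrightarrow> 0)"

text \<open>
  Only applied to Banach spaces: completeness of the spaces used here is \<open>complete_bcontfun\<close>
  above.  It is not a sort constraint because the library puts
  \<^typ>\<open>'a \<Rightarrow>\<^sub>C 'f\<close> into the class of complete spaces only for metric domains.
\<close>

definition strongly_gelfand_phillips ::
    "('f::real_normed_field \<Rightarrow> 'e::real_normed_vector \<Rightarrow> 'e) \<Rightarrow> bool" where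
  "strongly_gelfand_phillips smul \<longleftrightarrow>
     (\<exists>\<phi>. weak_star_null smul \<phi> \<and>
        (\<forall>B. bounded B \<and> \<not> precompact B \<longrightarrow> \<not> (\<lambda>n. norm_on B (\<phi> n)) \<longlonglongrightarrow> 0))"

definition isomorphic_subspaces ::
    "('f::real_normed_field \<Rightarrow> 'e::real_normed_vector \<Rightarrow> 'e) \<Rightarrow> 'e set \<Rightarrow>
     ('f \<Rightarrow> 'g::real_normed_vector \<Rightarrow> 'g) \<Rightarrow> 'g set \<Rightarrow> bool" where
  "isomorphic_subspaces s1 S s2 T \<longleftrightarrow>
     module.subspace s1 S \<and> module.subspace s2 T \<and>
     (\<exists>f g. homeomorphism S T f g \<and>
        (\<forall>x\<in>S. \<forall>y\<in>S. f (x + y) = f x + f y) \<and>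
        (\<forall>c. \<forall>x\<in>S. f (s1 c x) = s2 c (f x)))"


definition nonisolated_points :: "'a::topological_space set \<Rightarrow> 'a set" where
  "nonisolated_points A = {x \<in> A. \<not> x isolated_in A}"

lemma nonisolated_points_islimpt: "nonisolated_points A = {x \<in> A. x islimpt A}"
  by (auto simp: nonisolated_points_def isolated_in_islimpt_iff)

text \<open>
  The derivatives of finite order of the whole space, by the recursion used for all ordinals.
\<close>

function cb_derivative :: "nat \<Rightarrow> 'a::topological_space set" where
  "cb_derivative n =
     (if n = 0 then UNIV else (\<Inter>m\<in>{..<n}. nonisolated_points (cb_derivative m)))"
  by auto
termination
  by (relation less_than) auto

declare cb_derivative.simps [simp del]

lemma cb_derivative_0: "cb_derivative 0 = UNIV"
  by (simp add: cb_derivative.simps)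

lemma cb_derivative_Suc: "cb_derivative (Suc n) = nonisolated_points (cb_derivative n)"
proof (cases n)
  case 0
  then show ?thesis by (subst cb_derivative.simps) (simp add: lessThan_Suc)
next
  case (Suc k)
  have "cb_derivative (Suc n) =
      (\<Inter>m\<in>{..<n}. nonisolated_points (cb_derivative m)) \<inter> nonisolated_points (cb_derivative n)"
    by (subst cb_derivative.simps) (auto simp: less_Suc_eq)
  also have "(\<Inter>m\<in>{..<n}. nonisolated_points (cb_derivative m)) = cb_derivative n"
    using Suc by (subst (2) cb_derivative.simps) simp
  finally show ?thesis by (auto simp: nonisolated_points_def)
qed

definition finite_scattered_height :: "'a::topological_space itself \<Rightarrow> bool" where
  "finite_scattered_height _ \<longleftrightarrow> (\<exists>n. cb_derivative n = ({} :: 'a set))"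

end

theory Submission
  imports Defs
begin

text \<open>
  All four conditions are tied to one object: a linear map \<open>T : C(K) \<rightarrow> c\<^sub>0\<close> that is bounded and
  bounded below (\<open>bcf_embedding\<close>).  The argument is uniform in the scalar field; the implications
  run (i) \<open>\<leftrightarrow>\<close> (ii), (ii) \<open>\<rightarrow>\<close> (iv) \<open>\<rightarrow>\<close> (iii) \<open>\<rightarrow>\<close> (ii), the last one being trivial.

  (ii) \<open>\<rightarrow>\<close> (i).  The coordinates of \<open>T\<close> form a weak* null sequence.  If they tend to zero uniformly on
  a bounded set \<open>B\<close>, then up to a small error \<open>T(B)\<close> lives on finitely many coordinates, so it is
  totally bounded, and so is \<open>B\<close> (\<open>embedding_imp_strongly_gelfand_phillips\<close>).

  (i) \<open>\<rightarrow>\<close> (ii).  A weak* null sequence \<open>\<phi>\<close> that witnesses (i) defines a bounded map \<open>f \<mapsto> (\<phi>\<^sub>n f)\<close>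
  into \<open>c\<^sub>0\<close>.  It may fail to be bounded below, but it becomes so once finitely many point
  evaluations are put in front of it.  Otherwise one could choose unit vectors \<open>f\<^sub>n\<close> on which all the
  functionals are small and which are small at the peak points of \<open>f\<^sub>0, \<dots>, f\<^sub>n\<^sub>-\<^sub>1\<close>; the set of
  these \<open>f\<^sub>n\<close> is separated, yet \<open>\<phi>\<close> tends to zero uniformly on it
  (\<open>strongly_gelfand_phillips_test_points\<close>).

  (ii) \<open>\<rightarrow>\<close> (iv).  Bump functions with pairwise disjoint supports have images in \<open>c\<^sub>0\<close> whose
  coordinates are absolutely summable with a fixed bound, so among many of them one is small on any
  given finite set of coordinates.  Starting at a point of the \<open>n\<close>-th derivative, one can therefore
  stack \<open>n\<close> bumps, each supported where the preceding ones are equal to \<open>1\<close>, such that their images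
  are almost disjointly supported.  The sum of the bumps has norm at least \<open>n\<close>, while its image stays
  bounded, so \<open>n\<close> is bounded (\<open>tower_of_bumps\<close>).  Next, each difference of consecutive derivatives
  is discrete; bumps at its points are \<open>1\<close>-separated, and \<open>c\<^sub>0\<close> is separable, so these finitely many
  differences are countable, and so is \<open>K\<close>.  Finally, a countable pseudocompact Tychonoff space is
  compact.

  (iv) \<open>\<rightarrow>\<close> (iii).  A countable compact Hausdorff space is homeomorphic to a metric one, and mapping
  a point to a nearest non-isolated one is a continuous retraction of each derivative onto the next.
  Let \<open>(T f)(x)\<close> be the difference of \<open>f(x)\<close> and the value of \<open>f\<close> at the retracted point, which has
  larger rank, and let it be \<open>f(x)\<close> on the last nonempty derivative.  The function \<open>T f\<close> vanishes at
  infinity, and \<open>f\<close> is recovered by a recursion over the finitely many derivatives, so \<open>T\<close> is an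
  isomorphism onto the null sequences indexed by the points of \<open>K\<close> (locale \<open>cb_retractions\<close>).
\<close>

section \<open>Isomorphic embeddings of spaces of continuous functions\<close>

text \<open>
  Isomorphic embeddings of spaces of bounded continuous functions over the same scalar field.  One
  constant serves for boundedness from above and from below.
\<close>

definition bcf_embedding ::
    "(('a::topological_space \<Rightarrow>\<^sub>C 'f::real_normed_field) \<Rightarrow> ('b::topological_space \<Rightarrow>\<^sub>C 'f)) \<Rightarrow> bool" where
  "bcf_embedding T \<longleftrightarrow>
     (\<forall>f g. T (f + g) = T f + T g) \<and> (\<forall>c f. T (bcf_scale c f) = bcf_scale c (T f)) \<and>
     (\<exists>C. \<forall>f. norm (T f) \<le> C * norm f \<and> norm f \<le> C * norm (T f))"

lemma bcf_embeddingI: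
  assumes "\<And>f g. T (f + g) = T f + T g" "\<And>c f. T (bcf_scale c f) = bcf_scale c (T f)"
    and "\<And>f. norm (T f) \<le> A * norm f" "\<And>f. norm f \<le> B * norm (T f)"
  shows "bcf_embedding T"
proof -
  have "norm (T f) \<le> max A B * norm f \<and> norm f \<le> max A B * norm (T f)" for f
  proof -
    have "norm (T f) \<le> A * norm f" "norm f \<le> B * norm (T f)"
      by (rule assms)+
    moreover have "A * norm f \<le> max A B * norm f" "B * norm (T f) \<le> max A B * norm (T f)"
      by (intro mult_right_mono; simp)+
    ultimately show ?thesis by linarith
  qed
  with assms show ?thesis
    unfolding bcf_embedding_def by blast
qed

lemma bcf_embeddingE:
  assumes "bcf_embedding T"
  obtains C where "C > 0" "\<And>f. norm (T f) \<le> C * norm f" "\<And>f. norm f \<le> C * norm (T f)"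
    "bounded_linear T"
proof -
  obtain C where C: "\<And>f. norm (T f) \<le> C * norm f \<and> norm f \<le> C * norm (T f)"
    using assms unfolding bcf_embedding_def by blast
  have le: "C * norm g \<le> max C 1 * norm g" for g :: "'z::real_normed_vector"
    by (intro mult_right_mono) auto
  have scale: "T (r *\<^sub>R f) = r *\<^sub>R T f" for r f
    using assms unfolding bcf_embedding_def by (metis bcf_scale_of_real)
  have bl: "bounded_linear T"
  proof (rule bounded_linear_intro)
    show "norm (T f) \<le> norm f * C" for f
      using C[of f] by (simp add: mult.commute)
  qed (use assms scale in \<open>auto simp: bcf_embedding_def\<close>)
  show thesis
  proof (rule that[of "max C 1"])
    show "norm (T f) \<le> max C 1 * norm f" for f
      using C[of f] le[of f] by linarith
    show "norm f \<le> max C 1 * norm (T f)" for f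
      using C[of f] le[of "T f"] by linarith
  qed (use bl in auto)
qed

lemma subspace_UNIV_bcf: "module.subspace bcf_scale UNIV"
proof -
  interpret vector_space bcf_scale by (rule vector_space_bcf_scale)
  show ?thesis by (rule subspace_UNIV)
qed

text \<open>
  A nonzero vector is scaled to norm \<open>d / 2\<close>, where the bound on the ball applies; this is the source
  of the factor \<open>2\<close>.
\<close>

lemma homogeneous_bound_from_ball:
  fixes f :: "'a::real_normed_vector \<Rightarrow> 'b::real_normed_vector"
  assumes cone: "\<And>r x. x \<in> S \<Longrightarrow> r *\<^sub>R x \<in> S"
    and hom: "\<And>r x. x \<in> S \<Longrightarrow> f (r *\<^sub>R x) = r *\<^sub>R f x"
    and d: "d > 0" and bound: "\<And>x. x \<in> S \<Longrightarrow> norm x < d \<Longrightarrow> norm (f x) \<le> b"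
    and x: "x \<in> S"
  shows "norm (f x) \<le> (2 * b / d) * norm x"
proof (cases "x = 0")
  case True
  then show ?thesis using hom[OF x, of 0] by simp
next
  case False
  define r where "r = d / (2 * norm x)"
  have r: "r > 0" using d False by (simp add: r_def)
  have "norm (r *\<^sub>R x) < d"
    using d False by (simp add: r_def)
  then have "norm (f (r *\<^sub>R x)) \<le> b"
    by (intro bound cone x)
  then have "r * norm (f x) \<le> b"
    using r by (simp add: hom[OF x])
  then show ?thesis
    using d False by (simp add: r_def field_simps)
qed

lemma continuous_homogeneous_bound:
  fixes f :: "'a::real_normed_vector \<Rightarrow> 'b::real_normed_vector"
  assumes cone: "\<And>r x. x \<in> S \<Longrightarrow> r *\<^sub>R x \<in> S"
    and hom: "\<And>r x. x \<in> S \<Longrightarrow> f (r *\<^sub>R x) = r *\<^sub>R f x"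
    and cont: "continuous_on S f" and "0 \<in> S"
  obtains K where "\<And>x. x \<in> S \<Longrightarrow> norm (f x) \<le> K * norm x"
proof -
  have f0: "f 0 = 0"
    using hom[OF \<open>0 \<in> S\<close>, of 0] by simp
  obtain d where "d > 0" and d: "\<And>x. x \<in> S \<Longrightarrow> dist x 0 < d \<Longrightarrow> dist (f x) (f 0) < 1"
    using cont \<open>0 \<in> S\<close> unfolding continuous_on_iff by (metis zero_less_one)
  have "norm (f x) \<le> (2 * 1 / d) * norm x" if "x \<in> S" for x
    by (rule homogeneous_bound_from_ball[OF cone hom \<open>d > 0\<close> _ that])
      (use d f0 in \<open>auto intro: less_imp_le\<close>)
  then show thesis by (rule that)
qed

text \<open>
  A homeomorphism that respects the linear structure and its inverse are continuous at zero, which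
  gives the two norm estimates; conversely these estimates make the map and its inverse Lipschitz.
\<close>

lemma isomorphic_subspaces_bcf_iff:
  fixes S :: "('b::topological_space \<Rightarrow>\<^sub>C 'f::real_normed_field) set"
  shows "isomorphic_subspaces (bcf_scale :: 'f \<Rightarrow> ('a::topological_space \<Rightarrow>\<^sub>C 'f) \<Rightarrow> _) UNIV bcf_scale S \<longleftrightarrow>
    (\<exists>T :: ('a \<Rightarrow>\<^sub>C 'f) \<Rightarrow> _. bcf_embedding T \<and> range T = S)"
    (is "?L \<longleftrightarrow> ?R")
proof
  assume ?L
  then obtain T g where sub: "module.subspace bcf_scale S"
    and hom: "homeomorphism UNIV S T g"
    and add: "\<And>x y :: 'a \<Rightarrow>\<^sub>C 'f. T (x + y) = T x + T y"
    and scale: "\<And>c x. T (bcf_scale c x) = bcf_scale c (T x)"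
    unfolding isomorphic_subspaces_def by blast
  have scaleR: "T (r *\<^sub>R f) = r *\<^sub>R T f" for r f
    using scale by (metis bcf_scale_of_real)
  have T0: "T 0 = 0"
    using scaleR[of 0 0] by simp
  have gT: "g (T f) = f" for f
    using hom by (simp add: homeomorphism_def)
  have contT: "continuous_on UNIV T" and contg: "continuous_on S g" and ran: "range T = S"
    using hom by (auto simp: homeomorphism_def)
  have TS: "T f \<in> S" for f
    using ran by blast
  have "0 \<in> S" using TS[of 0] T0 by simp
  obtain K where K: "\<And>f. f \<in> UNIV \<Longrightarrow> norm (T f) \<le> K * norm f"
    by (rule continuous_homogeneous_bound[of UNIV T]) (auto simp: scaleR contT)
  have "r *\<^sub>R y \<in> S \<and> g (r *\<^sub>R y) = r *\<^sub>R g y" if "y \<in> S" for r y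
  proof -
    obtain f where "y = T f" using \<open>y \<in> S\<close> ran by blast
    then show ?thesis using TS[of "r *\<^sub>R f"] gT[of "r *\<^sub>R f"] by (simp add: scaleR gT)
  qed
  then obtain K' where K': "\<And>y. y \<in> S \<Longrightarrow> norm (g y) \<le> K' * norm y"
    using continuous_homogeneous_bound[of S g] contg \<open>0 \<in> S\<close> by metis
  have upper: "norm (T f) \<le> K * norm f" and lower: "norm f \<le> K' * norm (T f)" for f
    using K[of f] K'[OF TS, of f] by (simp_all add: gT)
  have "bcf_embedding T"
    using add scale upper lower by (rule bcf_embeddingI)
  with ran show ?R by blast
next
  assume ?R
  then obtain T :: "('a \<Rightarrow>\<^sub>C 'f) \<Rightarrow> ('b \<Rightarrow>\<^sub>C 'f)" where emb: "bcf_embedding T" and ran: "range T = S"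
    by blast
  obtain C where C: "C > 0" "\<And>f. norm f \<le> C * norm (T f)" and bl: "bounded_linear T"
    using bcf_embeddingE[OF emb] by metis
  interpret bl: bounded_linear T by (rule bl)
  have dist_le: "dist f g \<le> C * dist (T f) (T g)" for f g
    using C(2)[of "f - g"] by (simp add: dist_norm bl.diff)
  have inj: "inj T"
  proof (rule injI)
    fix f g assume "T f = T g"
    then have "dist f g \<le> 0" using dist_le[of f g] by simp
    then show "f = g" by simp
  qed
  have "homeomorphism UNIV S T (inv T)"
  proof (rule homeomorphismI)
    show "continuous_on UNIV T"
      by (intro bl.continuous_on continuous_on_id)
    show "continuous_on S (inv T)"
    proof (rule continuous_onI)
      fix y e assume y: "y \<in> S" and e: "(e::real) > 0"
      show "\<exists>d>0. \<forall>x'\<in>S. dist x' y < d \<longrightarrow> dist (inv T x') (inv T y) \<le> e"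
      proof (intro exI[of _ "e / C"] conjI ballI impI)
        fix x assume x: "x \<in> S" "dist x y < e / C"
        have "dist (inv T x) (inv T y) \<le> C * dist x y"
          using dist_le[of "inv T x" "inv T y"] x y ran by (simp add: f_inv_into_f)
        also have "\<dots> \<le> e"
          using x C(1) by (simp add: field_simps)
        finally show "dist (inv T x) (inv T y) \<le> e" .
      qed (use e C in auto)
    qed
  qed (use ran inj in \<open>auto simp: f_inv_into_f\<close>)
  moreover have "module.subspace bcf_scale S"
  proof -
    interpret vector_space "bcf_scale :: 'f \<Rightarrow> ('b \<Rightarrow>\<^sub>C 'f) \<Rightarrow> _" by (rule vector_space_bcf_scale)
    have add: "T f + T g = T (f + g)" and scale: "bcf_scale c (T f) = T (bcf_scale c f)" for f g c
      using emb by (simp_all add: bcf_embedding_def)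
    show ?thesis
      unfolding subspace_def ran[symmetric] by (auto simp: add scale intro: range_eqI[of _ _ 0] simp: bl.zero)
  qed
  ultimately show ?L
    using emb unfolding isomorphic_subspaces_def bcf_embedding_def
    by (auto simp: subspace_UNIV_bcf)
qed

lemma bounded_linear_bcf_nth:
  assumes "bcf_embedding T"
  shows "bounded_linear (\<lambda>f. apply_bcontfun (T f) k)"
proof -
  obtain C where C: "C > 0" "\<And>f. norm (T f) \<le> C * norm f" and "bounded_linear T"
    using bcf_embeddingE[OF assms] by metis
  interpret bounded_linear T by fact
  show ?thesis
  proof (rule bounded_linear_intro[where K = C])
    show "norm (apply_bcontfun (T f) k) \<le> norm f * C" for f
      using norm_bounded[of "T f" k] C(2)[of f] by (simp add: mult.commute)
  qed (simp_all add: add scaleR)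
qed

section \<open>Functionals and finite codes of null sequences\<close>

text \<open>
  The Banach--Steinhaus theorem, by the Baire category theorem: the closed sets on which the sequence is
  bounded by \<open>m\<close> cover the space, so one of them contains a ball.  Completeness is an assumption on
  \<open>UNIV\<close> and not a type class, so that the lemma applies to \<open>C(K)\<close> for a non-metric \<open>K\<close>.
\<close>

lemma uniform_boundedness:
  fixes \<phi> :: "nat \<Rightarrow> 'e::real_normed_vector \<Rightarrow> 'g::real_normed_vector"
  assumes complete: "complete (UNIV :: 'e set)"
    and bl: "\<And>n. bounded_linear (\<phi> n)"
    and pointwise: "\<And>x. bounded (range (\<lambda>n. \<phi> n x))"
  obtains C where "C > 0" "\<And>n x. norm (\<phi> n x) \<le> C * norm x"
proof -
  define A where "A m = {x. \<forall>n. norm (\<phi> n x) \<le> real m}" for m :: nat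
  have "closed (A m)" for m
  proof -
    have "A m = (\<Inter>n. {x. norm (\<phi> n x) \<le> real m})"
      by (auto simp: A_def)
    also have "closed \<dots>"
      by (intro closed_INT ballI closed_Collect_le continuous_intros bounded_linear.continuous_on[OF bl])
    finally show ?thesis .
  qed
  moreover have "(\<Union>m. A m) = UNIV"
  proof -
    have "x \<in> (\<Union>m. A m)" for x
    proof -
      obtain b where b: "\<And>n. norm (\<phi> n x) \<le> b"
        using pointwise[of x] by (auto simp: bounded_iff)
      obtain m where "b \<le> real m"
        using real_arch_simple by blast
      then have "x \<in> A m"
        using b by (auto simp: A_def intro: order.trans)
      then show ?thesis by blast
    qed
    then show ?thesis by blast
  qed
  moreover have "Met_TC.mcomplete TYPE('e)"
    using complete by (simp add: mcomplete_iff_complete)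
  ultimately obtain m where m: "interior (A m) \<noteq> {}"
  proof (rule_tac ccontr)
    assume closed: "\<And>m. closed (A m)" and un: "(\<Union>m. A m) = UNIV"
      and compl: "Met_TC.mcomplete TYPE('e)"
      and "\<not> thesis"
    assume "\<And>m. interior (A m) \<noteq> {} \<Longrightarrow> thesis"
    with \<open>\<not> thesis\<close> have int: "interior (A m) = {}" for m
      by blast
    have "Met_TC.mtopology interior_of \<Union> (range A) = {}"
      by (rule Met_TC.metric_Baire_category_alt[OF compl]) (auto simp: closed int)
    then show False
      by (simp add: un)
  qed
  then obtain x0 r where r: "r > 0" "ball x0 r \<subseteq> A m"
    by (meson all_not_in_conv mem_interior)
  \<comment> \<open>A ball around \<open>x0\<close> is moved to the origin at the cost of a factor \<open>2\<close>.\<close>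
  have small: "norm (\<phi> n y) \<le> 2 * real m" if "norm y < r" for n y
  proof -
    interpret bounded_linear "\<phi> n" by (rule bl)
    have "x0 + y \<in> A m" "x0 \<in> A m"
      using r that by (auto simp: dist_norm subset_iff)
    then have "norm (\<phi> n (x0 + y)) \<le> real m" "norm (\<phi> n x0) \<le> real m"
      by (auto simp: A_def)
    moreover have "\<phi> n y = \<phi> n (x0 + y) - \<phi> n x0"
      by (simp add: add)
    ultimately show ?thesis
      using norm_triangle_ineq4[of "\<phi> n (x0 + y)" "\<phi> n x0"] by simp
  qed
  have "norm (\<phi> n x) \<le> (2 * (2 * real m) / r) * norm x" for n x
    by (rule homogeneous_bound_from_ball[of UNIV])
      (use r small bounded_linear.axioms(1)[OF bl] in \<open>auto simp: linear_cmul\<close>)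
  moreover have "(2 * (2 * real m) / r) * norm x \<le> (2 * (2 * real m) / r + 1) * norm x" for x :: 'e
    by (intro mult_right_mono) auto
  ultimately have "norm (\<phi> n x) \<le> (2 * (2 * real m) / r + 1) * norm x" for n x
    using order_trans by blast
  moreover have "2 * (2 * real m) / r + 1 > 0"
    using r by (intro add_nonneg_pos) auto
  ultimately show thesis by (rule that[rotated])
qed

lemma dual_space_bcf_bounded_linear:
  assumes "\<phi> \<in> dual_space (bcf_scale :: 'f::real_normed_field \<Rightarrow> ('a::topological_space \<Rightarrow>\<^sub>C 'f) \<Rightarrow> _)"
  shows "bounded_linear \<phi>"
proof -
  have lin: "Vector_Spaces.linear bcf_scale (*) \<phi>" and cont: "continuous_on UNIV \<phi>"
    using assms by (auto simp: dual_space_def)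
  interpret l: Vector_Spaces.linear bcf_scale "(*)" \<phi> by (rule lin)
  have scaleR: "\<phi> (r *\<^sub>R f) = r *\<^sub>R \<phi> f" for r f
    using l.scale[of "of_real r" f] by (simp add: bcf_scale_of_real scaleR_conv_of_real)
  obtain K where K: "\<And>f. f \<in> UNIV \<Longrightarrow> norm (\<phi> f) \<le> K * norm f"
    by (rule continuous_homogeneous_bound[of UNIV \<phi>]) (auto simp: scaleR cont)
  show ?thesis
    by (rule bounded_linear_intro[where K = K]) (use K in \<open>simp_all add: l.add scaleR mult.commute\<close>)
qed

lemma dual_spaceI:
  assumes "bounded_linear \<phi>" "\<And>c f. \<phi> (bcf_scale c f) = c * \<phi> f"
  shows "\<phi> \<in> dual_space (bcf_scale :: 'f::real_normed_field \<Rightarrow> ('a::topological_space \<Rightarrow>\<^sub>C 'f) \<Rightarrow> _)"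
proof -
  interpret bounded_linear \<phi> by fact
  interpret vector_space "bcf_scale :: 'f \<Rightarrow> ('a \<Rightarrow>\<^sub>C 'f) \<Rightarrow> _" by (rule vector_space_bcf_scale)
  interpret f: vector_space "(*) :: 'f \<Rightarrow> 'f \<Rightarrow> 'f" by unfold_locales (auto simp: algebra_simps)
  have "Vector_Spaces.linear bcf_scale (*) \<phi>"
    by unfold_locales (simp_all add: add assms(2))
  then show ?thesis
    using continuous_on[OF continuous_on_id] by (simp add: dual_space_def)
qed

text \<open>
  Boundedness of \<open>B\<close> makes the supremum in \<open>norm_on\<close> a genuine upper bound.
\<close>

lemma norm_on_upper:
  assumes "bounded_linear \<phi>" "bounded B" "x \<in> B"
  shows "norm (\<phi> x) \<le> norm_on B \<phi>"
  unfolding norm_on_def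
proof (rule cSUP_upper[OF assms(3)])
  show "bdd_above ((\<lambda>x. norm (\<phi> x)) ` B)"
    using bounded_linear_image[OF assms(2,1)]
    by (auto simp: bounded_iff bdd_above_def)
qed

text \<open>
  Finite lists over a net \<open>G\<close> of scalars serve as approximate descriptions of the first \<open>M\<close> terms of
  a sequence.  They are finitely many if \<open>G\<close> is finite and countably many if \<open>G\<close> is countable; the
  first case gives total boundedness, the second one separability of \<open>c\<^sub>0\<close>.
\<close>

lemma list_code:
  fixes y :: "nat \<Rightarrow> 'g::metric_space"
  assumes "\<And>k. k < M \<Longrightarrow> \<exists>g\<in>G. dist (y k) g < \<delta>"
  obtains l where "l \<in> lists G" "length l = M" "\<And>k. k < M \<Longrightarrow> dist (y k) (l ! k) < \<delta>"
proof -
  obtain g where "\<And>k. k < M \<Longrightarrow> g k \<in> G \<and> dist (y k) (g k) < \<delta>"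
    using assms by metis
  then show thesis
    by (intro that[of "map g [0..<M]"]) (auto simp: in_lists_conv_set)
qed

lemma dist_le_if_same_code:
  fixes y z :: "nat \<Rightarrow>\<^sub>C 'f::real_normed_vector"
  assumes "\<And>k. k < M \<Longrightarrow> dist (y k) (l ! k) < \<delta>" "\<And>k. k \<ge> M \<Longrightarrow> norm (y k) < \<delta>"
    and "\<And>k. k < M \<Longrightarrow> dist (z k) (l ! k) < \<delta>" "\<And>k. k \<ge> M \<Longrightarrow> norm (z k) < \<delta>"
  shows "dist y z \<le> 2 * \<delta>"
proof (rule dist_bound)
  fix k
  show "dist (y k) (z k) \<le> 2 * \<delta>"
  proof (cases "k < M")
    case True
    then show ?thesis
      using assms(1,3)[of k] dist_triangle2[of "y k" "z k" "l ! k"] by simp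
  next
    case False
    then show ?thesis
      using assms(2,4)[of k] norm_triangle_ineq4[of "y k" "z k"] by (simp add: dist_norm)
  qed
qed

section \<open>The strong Gelfand--Phillips property as embeddability into the null sequences\<close>

lemma c_null_eventually_small:
  assumes "y \<in> c_null" "\<delta> > 0"
  obtains M where "\<And>k. k \<ge> M \<Longrightarrow> norm (apply_bcontfun y k) < \<delta>"
  using assms unfolding c_null_def by (auto simp: LIMSEQ_iff)

text \<open>
  The coordinates of the embedding are the required functionals.  If they tend to zero uniformly on
  \<open>B\<close>, then a member of \<open>B\<close> is determined up to a small error by finitely many coordinates of its
  image, each of which ranges over a compact set of scalars.
\<close>

lemma embedding_imp_strongly_gelfand_phillips:
  fixes T :: "('k::topological_space \<Rightarrow>\<^sub>C 'f::{real_normed_field,heine_borel}) \<Rightarrow> (nat \<Rightarrow>\<^sub>C 'f)"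
  assumes emb: "bcf_embedding T" and ran: "range T \<subseteq> c_null"
  shows "strongly_gelfand_phillips (bcf_scale :: 'f \<Rightarrow> ('k \<Rightarrow>\<^sub>C 'f) \<Rightarrow> _)"
proof -
  obtain C where C: "C > 0" "\<And>f. norm (T f) \<le> C * norm f" "\<And>f. norm f \<le> C * norm (T f)"
    and "bounded_linear T"
    using bcf_embeddingE[OF emb] by metis
  interpret T: bounded_linear T by fact
  define \<phi> where "\<phi> k f = apply_bcontfun (T f) k" for k f
  have bl: "bounded_linear (\<phi> k)" for k
    unfolding \<phi>_def by (rule bounded_linear_bcf_nth[OF emb])
  have "weak_star_null bcf_scale \<phi>"
    unfolding weak_star_null_def
  proof (intro conjI allI)
    show "\<phi> n \<in> dual_space bcf_scale" for n
      by (rule dual_spaceI[OF bl]) (use emb in \<open>simp add: \<phi>_def bcf_embedding_def\<close>)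
    show "(\<lambda>n. \<phi> n x) \<longlonglongrightarrow> 0" for x
      using ran by (auto simp: \<phi>_def c_null_def)
  qed
  moreover have "precompact B" if B: "bounded B" and null: "(\<lambda>n. norm_on B (\<phi> n)) \<longlonglongrightarrow> 0" for B
  proof -
    obtain b where b: "\<And>f. f \<in> B \<Longrightarrow> norm f \<le> b"
      using B by (auto simp: bounded_iff)
    have net: "\<exists>F. finite F \<and> B \<subseteq> (\<Union>f\<in>F. ball f e)" if e: "e > 0" for e
    proof -
      define \<delta> where "\<delta> = e / (4 * C)"
      have \<delta>: "\<delta> > 0" using e C by (simp add: \<delta>_def)
      obtain M where M: "\<And>k. k \<ge> M \<Longrightarrow> norm_on B (\<phi> k) < \<delta>"
        using order_tendstoD(2)[OF null \<delta>] by (auto simp: eventually_sequentially)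
      have tail: "norm (T f k) < \<delta>" if "f \<in> B" "k \<ge> M" for f k
        using norm_on_upper[OF bl B that(1), of k] M[OF that(2)] by (simp add: \<phi>_def)
      have val: "T f k \<in> cball 0 (C * b)" if "f \<in> B" for f k
      proof -
        have "norm (T f k) \<le> C * norm f"
          using norm_bounded[of "T f" k] C(2)[of f] by linarith
        also have "\<dots> \<le> C * b"
          using b[OF that] C by simp
        finally show ?thesis by simp
      qed
      have "compact (cball (0::'f) (C * b))"
        by simp
      then obtain G where G: "finite G" "cball (0::'f) (C * b) \<subseteq> (\<Union>g\<in>G. ball g \<delta>)"
        using \<delta> unfolding compact_eq_totally_bounded by blast
      define L where "L = {l. set l \<subseteq> G \<and> length l = M}"
      have "finite L"
        unfolding L_def by (rule finite_lists_length_eq[OF G(1)])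
      define codes where "codes l f \<longleftrightarrow> f \<in> B \<and> (\<forall>k<M. dist (T f k) (l ! k) < \<delta>)" for l f
      have ex: "\<exists>l\<in>L. codes l f" if f: "f \<in> B" for f
      proof -
        have "\<exists>g\<in>G. dist (T f k) g < \<delta>" for k
          using val[OF f, of k] G(2) by (force simp: dist_commute)
        then obtain l where "l \<in> lists G" "length l = M" "\<And>k. k < M \<Longrightarrow> dist (T f k) (l ! k) < \<delta>"
          using list_code[where y = "apply_bcontfun (T f)" and M = M and G = G and \<delta> = \<delta>] by metis
        then show ?thesis
          using f by (auto simp: codes_def L_def in_lists_conv_set)
      qed
      define rep where "rep l = (SOME f. codes l f)" for l
      have "B \<subseteq> (\<Union>f\<in>rep ` L. ball f e)"
      proof
        fix f assume f: "f \<in> B"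
        then obtain l where l: "l \<in> L" "codes l f" using ex by blast
        then have r: "codes l (rep l)" unfolding rep_def by (metis someI)
        have "dist (T (rep l)) (T f) \<le> 2 * \<delta>"
          by (rule dist_le_if_same_code[where M = M and l = l])
            (use l r tail in \<open>auto simp: codes_def\<close>)
        then have "C * norm (T (rep l - f)) \<le> C * (2 * \<delta>)"
          using C(1) by (intro mult_left_mono) (auto simp: dist_norm T.diff)
        then have "norm (rep l - f) \<le> C * (2 * \<delta>)"
          using C(3)[of "rep l - f"] by linarith
        also have "\<dots> < e"
          using C e by (simp add: \<delta>_def)
        finally show "f \<in> (\<Union>f\<in>rep ` L. ball f e)"
          using l(1) by (auto simp: dist_norm)
      qed
      with \<open>finite L\<close> show ?thesis by blast
    qed
    show ?thesis
      unfolding precompact_def compact_eq_totally_bounded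
    proof (intro conjI allI impI)
      show "complete (closure B)"
        by (rule complete_closed_subset[OF closed_closure subset_UNIV complete_bcontfun])
      fix e :: real assume e: "e > 0"
      obtain F where F: "finite F" "B \<subseteq> (\<Union>f\<in>F. ball f (e / 2))"
        using net[of "e / 2"] e by auto
      have "closure B \<subseteq> (\<Union>f\<in>F. ball f e)"
      proof
        fix f assume "f \<in> closure B"
        then obtain g where g: "g \<in> B" "dist g f < e / 2"
          using e by (meson closure_approachable half_gt_zero)
        then obtain h where "h \<in> F" "dist h g < e / 2" using F by auto
        then show "f \<in> (\<Union>f\<in>F. ball f e)"
          using g dist_triangle_half_r[of g h e f] by (auto simp: dist_commute)
      qed
      with F(1) show "\<exists>k. finite k \<and> closure B \<subseteq> (\<Union>x\<in>k. ball x e)" by blast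
    qed
  qed
  ultimately show ?thesis
    unfolding strongly_gelfand_phillips_def by blast
qed

lemma c_null_bcontfunI:
  assumes "x \<longlonglongrightarrow> 0"
  obtains y :: "nat \<Rightarrow>\<^sub>C 'f::real_normed_field" where "y \<in> c_null" "\<And>n. apply_bcontfun y n = x n"
proof -
  have "bounded (range x)"
    using assms by (rule convergent_imp_bounded)
  then have "x \<in> bcontfun"
    by (simp add: bcontfun_def)
  then show thesis
    using assms by (intro that[of "Bcontfun x"]) (simp_all add: c_null_def Bcontfun_inverse)
qed

text \<open>
  If no finite set of points worked, a recursion would produce unit vectors \<open>f\<^sub>n\<close> with peak points \<open>x\<^sub>n\<close>
  such that \<open>f\<^sub>n\<close> is at most \<open>1/4\<close> at all earlier peak points and all functionals are at most
  \<open>1/(n+1)\<close> at \<open>f\<^sub>n\<close>.  The functionals then converge to zero uniformly on the set of all \<open>f\<^sub>n\<close>, although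
  its points have mutual distance at least \<open>1/4\<close>.
\<close>

lemma strongly_gelfand_phillips_test_points:
  fixes \<phi> :: "nat \<Rightarrow> ('k::topological_space \<Rightarrow>\<^sub>C 'f::real_normed_field) \<Rightarrow> 'f"
  assumes bl: "\<And>n. bounded_linear (\<phi> n)" and lim: "\<And>f. (\<lambda>n. \<phi> n f) \<longlonglongrightarrow> 0"
    and sgp: "\<And>B. bounded B \<Longrightarrow> (\<lambda>n. norm_on B (\<phi> n)) \<longlonglongrightarrow> 0 \<Longrightarrow> precompact B"
  obtains ps and \<delta> :: real where "\<delta> > 0"
    "\<And>f. norm f = 1 \<Longrightarrow> (\<exists>p\<in>set ps. norm (apply_bcontfun f p) > \<delta>) \<or> (\<exists>n. norm (\<phi> n f) > \<delta>)"
proof (rule ccontr)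
  note witness = that
  assume "\<not> thesis"
  then have small: "\<exists>f. norm f = 1 \<and> (\<forall>p\<in>set ps. norm (apply_bcontfun f p) \<le> \<delta>) \<and>
      (\<forall>n. norm (\<phi> n f) \<le> \<delta>)" if "\<delta> > 0" for ps and \<delta> :: real
    using that witness[of \<delta> ps] by (meson not_le)
  define P where "P F n r \<longleftrightarrow> norm (fst r) = 1 \<and> norm (apply_bcontfun (fst r) (snd r)) > 1/2 \<and>
      (\<forall>m<n. norm (apply_bcontfun (fst r) (snd (F m))) \<le> 1/4) \<and>
      (\<forall>k. norm (\<phi> k (fst r)) \<le> 1 / Suc n)"
    for F :: "nat \<Rightarrow> ('k \<Rightarrow>\<^sub>C 'f) \<times> 'k" and n and r :: "('k \<Rightarrow>\<^sub>C 'f) \<times> 'k"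
  have "\<exists>F. \<forall>n. P F n (F n)"
  proof (rule dependent_wellorder_choice)
    fix n and F :: "nat \<Rightarrow> ('k \<Rightarrow>\<^sub>C 'f) \<times> 'k"
    \<comment> \<open>The evaluations at earlier peak points must be small enough to separate the vectors, whereas the
       functionals must tend to zero.\<close>
    define \<delta> :: real where "\<delta> = min (1/4) (1 / Suc n)"
    have "\<delta> > 0" by (simp add: \<delta>_def)
    then obtain f where f: "norm f = 1" "\<forall>p\<in>set (map (\<lambda>m. snd (F m)) [0..<n]). norm (apply_bcontfun f p) \<le> \<delta>"
        "\<forall>k. norm (\<phi> k f) \<le> \<delta>"
      using small[of \<delta> "map (\<lambda>m. snd (F m)) [0..<n]"] by blast
    obtain x where x: "norm (f x) > 1/2"
    proof (rule ccontr)
      assume "\<not> thesis"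
      then have "norm (f x) \<le> 1/2" for x
        using that not_le by blast
      then have "norm f \<le> 1/2" by (rule norm_bound)
      with f(1) show False by simp
    qed
    have "P F n (f, x)"
      using f x by (auto simp: P_def \<delta>_def)
    then show "\<exists>r. P F n r" ..
  qed (auto simp: P_def)
  then obtain F where F: "\<And>n. P F n (F n)" by blast
  define f where "f n = fst (F n)" for n
  define x where "x n = snd (F n)" for n
  have f1: "norm (f n) = 1" and fx: "norm (f n (x n)) > 1/2"
    and fm: "\<And>m. m < n \<Longrightarrow> norm (f n (x m)) \<le> 1/4" and f\<phi>: "\<And>k. norm (\<phi> k (f n)) \<le> 1 / real (Suc n)" for n
    using F[of n] by (auto simp: P_def f_def x_def)
  have sep: "dist (f n) (f m) \<ge> 1/4" if "m < n" for m n
  proof -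
    have "1/4 \<le> norm (f m (x m)) - norm (f n (x m))"
      using fx[of m] fm[OF that] by simp
    also have "\<dots> \<le> dist (f n (x m)) (f m (x m))"
      using norm_triangle_ineq2[of "f m (x m)" "f n (x m)"] by (simp add: dist_norm norm_minus_commute)
    also have "\<dots> \<le> dist (f n) (f m)"
      by (rule dist_bounded)
    finally show ?thesis .
  qed
  have "bounded (range f)"
    by (auto simp: bounded_iff f1 intro!: exI[of _ 1])
  moreover have "(\<lambda>k. norm_on (range f) (\<phi> k)) \<longlonglongrightarrow> 0"
  proof (rule LIMSEQ_I)
    fix e :: real assume e: "e > 0"
    obtain N where N: "1 / Suc N < e / 2"
      using e by (metis half_gt_zero nat_approx_posE)
    have "\<forall>\<^sub>F k in sequentially. \<forall>n\<in>{..<N}. norm (\<phi> k (f n)) < e / 2"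
    proof (intro eventually_ball_finite ballI)
      show "\<forall>\<^sub>F k in sequentially. norm (\<phi> k (f n)) < e / 2" for n
        using tendstoD[OF lim[of "f n"], of "e / 2"] e by simp
    qed simp
    then obtain K where K: "\<And>k n. k \<ge> K \<Longrightarrow> n < N \<Longrightarrow> norm (\<phi> k (f n)) < e / 2"
      by (auto simp: eventually_sequentially)
    show "\<exists>no. \<forall>k\<ge>no. norm (norm_on (range f) (\<phi> k) - 0) < e"
    proof (intro exI allI impI)
      fix k assume k: "k \<ge> K"
      have le: "norm (\<phi> k (f n)) \<le> e / 2" for n
      proof (cases "n < N")
        case False
        then have "1 / real (Suc n) \<le> 1 / Suc N" by (simp add: frac_le)
        then show ?thesis using f\<phi>[of k n] N by linarith
      qed (use K[OF k] in \<open>simp add: less_imp_le\<close>)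
      then have "norm_on (range f) (\<phi> k) \<le> e / 2"
        unfolding norm_on_def by (intro cSUP_least) auto
      moreover have "0 \<le> norm_on (range f) (\<phi> k)"
        by (rule order_trans[OF norm_ge_zero norm_on_upper[OF bl \<open>bounded (range f)\<close> rangeI[of f 0]]])
      ultimately show "norm (norm_on (range f) (\<phi> k) - 0) < e"
        using e by simp
    qed
  qed
  ultimately have "compact (closure (range f))"
    unfolding precompact_def[symmetric] by (rule sgp)
  moreover have "\<forall>n. f n \<in> closure (range f)"
    by (simp add: closure_subset[THEN subsetD])
  ultimately obtain l r where r: "strict_mono r" "(f \<circ> r) \<longlonglongrightarrow> l"
    unfolding compact_def by metis
  then have "Cauchy (f \<circ> r)"
    by (intro LIMSEQ_imp_Cauchy)
  then obtain N where N: "\<And>m n. m \<ge> N \<Longrightarrow> n \<ge> N \<Longrightarrow> dist ((f \<circ> r) m) ((f \<circ> r) n) < 1/4"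
    using metric_CauchyD[of "f \<circ> r" "1/4"] by auto
  have "dist (f (r (Suc N))) (f (r N)) < 1/4"
    using N[of "Suc N" N] by simp
  then show False
    using sep[of "r N" "r (Suc N)"] r(1) by (simp add: strict_mono_def)
qed

text \<open>
  Listing the values at the finitely many test points before the values of the functionals keeps the
  image in \<open>c\<^sub>0\<close> and makes the map bounded below.
\<close>

lemma strongly_gelfand_phillips_imp_embedding:
  assumes "strongly_gelfand_phillips
    (bcf_scale :: 'f::{real_normed_field,complete_space} \<Rightarrow> ('k::topological_space \<Rightarrow>\<^sub>C 'f) \<Rightarrow> _)"
  obtains T :: "('k::topological_space \<Rightarrow>\<^sub>C 'f::{real_normed_field,complete_space}) \<Rightarrow> (nat \<Rightarrow>\<^sub>C 'f)" where "bcf_embedding T" "range T \<subseteq> c_null"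
proof -
  obtain \<phi> where null: "weak_star_null (bcf_scale :: 'f \<Rightarrow> ('k \<Rightarrow>\<^sub>C 'f) \<Rightarrow> _) \<phi>"
    and sgp: "\<And>B. bounded B \<Longrightarrow> (\<lambda>n. norm_on B (\<phi> n)) \<longlonglongrightarrow> 0 \<Longrightarrow> precompact B"
    using assms unfolding strongly_gelfand_phillips_def by blast
  have dual: "\<phi> n \<in> dual_space bcf_scale" and lim: "(\<lambda>n. \<phi> n f) \<longlonglongrightarrow> 0" for n f
    using null by (auto simp: weak_star_null_def)
  have bl: "bounded_linear (\<phi> n)" for n
    by (rule dual_space_bcf_bounded_linear[OF dual])
  have \<phi>_scale: "\<phi> n (bcf_scale c f) = c * \<phi> n f" for n c f
  proof -
    interpret Vector_Spaces.linear bcf_scale "(*)" "\<phi> n"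
      using dual[of n] by (simp add: dual_space_def)
    show ?thesis by (rule scale)
  qed
  obtain C where C: "C > 0" "\<And>n f. norm (\<phi> n f) \<le> C * norm f"
    using uniform_boundedness[OF complete_bcontfun bl convergent_imp_bounded[OF lim]] by metis
  obtain ps \<delta> where \<delta>: "\<delta> > 0"
    and test: "\<And>f. norm f = 1 \<Longrightarrow> (\<exists>p\<in>set ps. norm (apply_bcontfun f p) > \<delta>) \<or> (\<exists>n. norm (\<phi> n f) > \<delta>)"
    using strongly_gelfand_phillips_test_points[OF bl lim sgp] by metis
  \<comment> \<open>A shift by \<open>length ps\<close> makes room for the evaluations at the test points.\<close>
  define t where "t f n = (if n < length ps then apply_bcontfun f (ps ! n) else \<phi> (n - length ps) f)"
    for f :: "'k \<Rightarrow>\<^sub>C 'f" and n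
  have "(\<lambda>n. t f n) \<longlonglongrightarrow> 0" for f
  proof (rule LIMSEQ_offset[where k = "length ps"])
    show "(\<lambda>n. t f (n + length ps)) \<longlonglongrightarrow> 0"
      using lim[of f] by (simp add: t_def)
  qed
  then have "\<exists>y\<in>c_null. \<forall>n. apply_bcontfun y n = t f n" for f
    using c_null_bcontfunI[of "t f"] by metis
  then obtain T where T: "\<And>f. T f \<in> c_null" "\<And>f n. apply_bcontfun (T f) n = t f n"
    by metis
  have scale: "T (bcf_scale c f) = bcf_scale c (T f)" for c f
    by (rule bcontfun_eqI) (simp add: T t_def \<phi>_scale)
  have "bcf_embedding T"
  proof (rule bcf_embeddingI)
    show "T (f + g) = T f + T g" for f g
      by (rule bcontfun_eqI) (simp add: T t_def bounded_linear.axioms(1)[OF bl, THEN linear_add])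
    show "norm (T f) \<le> max 1 C * norm f" for f
    proof (rule norm_bound)
      fix n
      have "norm (f (ps ! n)) \<le> 1 * norm f"
        using norm_bounded[of f "ps ! n"] by simp
      moreover have "1 * norm f \<le> max 1 C * norm f" "C * norm f \<le> max 1 C * norm f"
        by (intro mult_right_mono; simp)+
      ultimately show "norm (T f n) \<le> max 1 C * norm f"
        using C(2)[of "n - length ps" f] by (simp add: T t_def)
    qed
    show "norm f \<le> (1 / \<delta>) * norm (T f)" for f
    proof (cases "f = 0")
      case False
      define g where "g = (1 / norm f) *\<^sub>R f"
      have "norm g = 1"
        using False by (simp add: g_def)
      have "T g = (1 / norm f) *\<^sub>R T f"
        using scale[of "of_real (1 / norm f)" f] unfolding g_def bcf_scale_of_real .
      then have Tg: "norm (T g) = norm (T f) / norm f"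
        by simp
      have "\<exists>n. norm (t g n) > \<delta>"
        using test[OF \<open>norm g = 1\<close>]
      proof
        assume "\<exists>p\<in>set ps. norm (g p) > \<delta>"
        then obtain i where "i < length ps" "norm (g (ps ! i)) > \<delta>"
          by (auto simp: in_set_conv_nth)
        then show ?thesis by (intro exI[of _ i]) (simp add: t_def)
      next
        assume "\<exists>n. norm (\<phi> n g) > \<delta>"
        then obtain n where "norm (\<phi> n g) > \<delta>" ..
        then show ?thesis by (intro exI[of _ "n + length ps"]) (simp add: t_def)
      qed
      then have "\<delta> \<le> norm (T g)"
        using norm_bounded[of "T g"] by (metis T(2) less_imp_le order_trans)
      then show ?thesis
        using \<delta> False by (simp add: Tg field_simps)
    qed (use \<delta> in simp)
  qed (rule scale)
  with T(1) show thesis by (intro that) auto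
qed

section \<open>Functions on Tychonoff spaces\<close>

lemma tychonoff_separating_function:
  fixes U :: "'k::topological_space set"
  assumes tych: "tychonoff_space (euclidean :: 'k topology)" and U: "open U" "x \<in> U"
  obtains h :: "'k \<Rightarrow> real" where "continuous_on UNIV h" "\<And>y. 0 \<le> h y" "\<And>y. h y \<le> 1"
    "h x = 1" "\<And>y. y \<notin> U \<Longrightarrow> h y = 0"
proof -
  have "closedin euclidean (- U) \<and> x \<in> topspace euclidean - (- U)"
    using U by (simp add: closed_Compl)
  then obtain f :: "'k \<Rightarrow> real" where f: "continuous_map euclidean (top_of_set {0..1}) f" "f x = 0"
      "f ` (- U) \<subseteq> {1}"
    using tych unfolding tychonoff_space_def completely_regular_space_def by blast
  have "continuous_on UNIV f" and f01: "\<And>y. f y \<in> {0..1}"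
    using f(1) by (auto simp: continuous_map_in_subtopology)
  then show thesis
    using f(2,3) by (intro that[of "\<lambda>y. 1 - f y"]) (auto intro!: continuous_intros)
qed

lemma tychonoff_separation:
  fixes x y :: "'k::topological_space"
  assumes "tychonoff_space (euclidean :: 'k topology)" "x \<noteq> y"
  obtains U V where "open U" "open V" "x \<in> U" "y \<in> V" "U \<inter> V = {}"
proof -
  have "\<exists>U V. open U \<and> open V \<and> x \<in> U \<and> y \<in> V \<and> U \<inter> V = {}"
    using assms unfolding tychonoff_space_def Hausdorff_space_def by (simp add: disjnt_def)
  then show thesis using that by blast
qed

lemma tychonoff_closed_singleton:
  assumes "tychonoff_space (euclidean :: 'k::topological_space topology)"
  shows "closed {x :: 'k}"
proof -
  have "\<exists>W. open W \<and> y \<in> W \<and> W \<subseteq> - {x}" if y: "y \<in> - {x}" for y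
  proof -
    obtain U V where "open U" "open V" "x \<in> U" "y \<in> V" "U \<inter> V = {}"
      using tychonoff_separation[OF assms, of x y] y by blast
    then show ?thesis by blast
  qed
  then have "open (- {x})"
    by (subst open_subopen) blast
  then show ?thesis by (simp add: closed_def)
qed

text \<open>
  The plateau \<open>W\<close> on which the bump is constantly \<open>1\<close> leaves room for further bumps to be stacked on
  top of it.
\<close>

lemma bcf_plateau:
  fixes U :: "'k::topological_space set"
  assumes tych: "tychonoff_space (euclidean :: 'k topology)" and U: "open U" "x \<in> U"
  obtains f :: "'k \<Rightarrow>\<^sub>C 'f::real_normed_field" and W where "open W" "x \<in> W" "W \<subseteq> U"
    "\<And>y. y \<in> W \<Longrightarrow> f y = 1" "\<And>y. y \<notin> U \<Longrightarrow> f y = 0" "\<And>y. norm (f y) \<le> 1"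
proof -
  obtain h :: "'k \<Rightarrow> real" where h: "continuous_on UNIV h" "\<And>y. 0 \<le> h y" "\<And>y. h y \<le> 1"
      "h x = 1" "\<And>y. y \<notin> U \<Longrightarrow> h y = 0"
    using tychonoff_separating_function[OF assms] by metis
  define p where "p y = min 1 (2 * h y)" for y
  have p: "0 \<le> p y" "p y \<le> 1" for y
    using h(2)[of y] by (auto simp: p_def)
  have "(\<lambda>y. of_real (p y) :: 'f) \<in> bcontfun"
  proof (rule bcontfun_normI)
    show "continuous_on UNIV (\<lambda>y. of_real (p y) :: 'f)"
      unfolding p_def by (intro continuous_intros h(1))
    show "norm (of_real (p y) :: 'f) \<le> 1" for y
      using p[of y] by simp
  qed
  then obtain f :: "'k \<Rightarrow>\<^sub>C 'f" where f: "(\<lambda>y. of_real (p y)) = apply_bcontfun f"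
    by (rule bcontfunE)
  have f: "apply_bcontfun f y = of_real (p y)" for y
    by (simp flip: f)
  show thesis
  proof (rule that[of "{y. 1 / 2 < h y}" f])
    show "open {y. 1 / 2 < h y}"
      by (intro open_Collect_less continuous_intros h(1))
    show "{y. 1 / 2 < h y} \<subseteq> U"
      using h(5) by (force simp: not_less)
  qed (use h p in \<open>auto simp: f p_def\<close>)
qed

section \<open>Embeddability into the null sequences bounds the scattered height\<close>

text \<open>
  Points are split off from \<open>x\<close> one after the other; the next ones are searched for in a
  neighbourhood of \<open>x\<close> that is disjoint from the neighbourhoods chosen so far.
\<close>

lemma disjoint_neighbourhoods_islimpt:
  fixes x :: "'k::topological_space" and n :: nat
  assumes tych: "tychonoff_space (euclidean :: 'k topology)" and lim: "x islimpt A"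
    and V: "open V" "x \<in> V"
  shows "\<exists>p U. (\<forall>j<n. p j \<in> A \<and> p j \<in> U j \<and> open (U j) \<and> U j \<subseteq> V) \<and>
               (\<forall>i<n. \<forall>j<n. i \<noteq> j \<longrightarrow> U i \<inter> U j = {})"
  using V
proof (induction n arbitrary: V)
  case (Suc n)
  obtain y where y: "y \<in> A" "y \<in> V" "y \<noteq> x"
    using lim Suc.prems by (meson islimptE)
  obtain U0 V0 where sep: "open U0" "open V0" "y \<in> U0" "x \<in> V0" "U0 \<inter> V0 = {}"
    using tychonoff_separation[OF tych y(3)] by metis
  obtain p U where IH: "\<forall>j<n. p j \<in> A \<and> p j \<in> U j \<and> open (U j) \<and> U j \<subseteq> V \<inter> V0"
      "\<forall>i<n. \<forall>j<n. i \<noteq> j \<longrightarrow> U i \<inter> U j = {}"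
    using Suc.IH[of "V \<inter> V0"] Suc.prems sep by (metis IntI open_Int)
  show ?case
  proof (intro exI conjI allI impI)
    fix i j assume "i < Suc n" "j < Suc n" "i \<noteq> j"
    then show "(U(n := U0 \<inter> V)) i \<inter> (U(n := U0 \<inter> V)) j = {}"
      using IH sep(5) unfolding less_Suc_eq fun_upd_def by (simp split: if_splits) blast+
  next
    fix j assume "j < Suc n"
    then show "(p(n := y)) j \<in> A" "(p(n := y)) j \<in> (U(n := U0 \<inter> V)) j"
      "open ((U(n := U0 \<inter> V)) j)" "(U(n := U0 \<inter> V)) j \<subseteq> V"
      using IH sep y Suc.prems by (auto simp: less_Suc_eq)
  qed
qed auto

lemma apply_bcontfun_sum: "apply_bcontfun (sum f A) x = (\<Sum>i\<in>A. apply_bcontfun (f i) x)"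
  by (induction A rule: infinite_finite_induct) auto

text \<open>
  After multiplication by suitable unimodular scalars the \<open>k\<close>-th coordinates of the images become
  nonnegative, so their sum is the \<open>k\<close>-th coordinate of the image of a single function, which still
  has norm at most \<open>1\<close> because the supports are disjoint.
\<close>

lemma sum_coordinates_disjoint_supports:
  fixes T :: "('k::topological_space \<Rightarrow>\<^sub>C 'f::real_normed_field) \<Rightarrow> (nat \<Rightarrow>\<^sub>C 'f)"
  assumes emb: "bcf_embedding T" and C: "\<And>f. norm (T f) \<le> C * norm f" "C > 0"
    and "finite J" and le1: "\<And>j y. j \<in> J \<Longrightarrow> norm (apply_bcontfun (f j) y) \<le> 1"
    and disj: "\<And>i j y. i \<in> J \<Longrightarrow> j \<in> J \<Longrightarrow> i \<noteq> j \<Longrightarrow> f i y = 0 \<or> f j y = 0"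
  shows "(\<Sum>j\<in>J. norm (T (f j) k)) \<le> C"
proof -
  \<comment> \<open>The scalar turns the coordinate into its absolute value; the value \<open>1\<close> keeps it unimodular where the
     coordinate vanishes.\<close>
  define c :: "'a \<Rightarrow> 'f" where "c j = (if T (f j) k = 0 then 1 else of_real (norm (T (f j) k)) / T (f j) k)" for j
  have c1: "norm (c j) = 1" and ck: "c j * T (f j) k = of_real (norm (T (f j) k))" for j
    by (auto simp: c_def norm_divide)
  define g where "g = (\<Sum>j\<in>J. bcf_scale (c j) (f j))"
  have "norm (g y) \<le> 1" for y
  proof (cases "\<exists>i\<in>J. f i y \<noteq> 0")
    case True
    then obtain i where i: "i \<in> J" "f i y \<noteq> 0" by blast
    have "g y = (\<Sum>j\<in>J. c j * f j y)"
      by (simp add: g_def apply_bcontfun_sum)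
    also have "\<dots> = (\<Sum>j\<in>{i}. c j * f j y)"
      by (rule sum.mono_neutral_right) (use \<open>finite J\<close> i disj in auto)
    finally show ?thesis
      using le1[OF i(1), of y] by (simp add: norm_mult c1)
  next
    case False
    then show ?thesis by (simp add: g_def apply_bcontfun_sum)
  qed
  then have "norm g \<le> 1" by (rule norm_bound)
  interpret T: bounded_linear T
    by (rule bcf_embeddingE[OF emb])
  have "T (bcf_scale (c j) (f j)) k = of_real (norm (T (f j) k))" for j
    using emb ck by (simp add: bcf_embedding_def)
  then have "T g k = of_real (\<Sum>j\<in>J. norm (T (f j) k))"
    by (simp add: g_def T.sum apply_bcontfun_sum)
  then have "(\<Sum>j\<in>J. norm (T (f j) k)) = norm (T g k)"
    by (simp only: norm_of_real) (simp add: sum_nonneg)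
  also have "\<dots> \<le> norm (T g)" by (rule norm_bounded)
  also have "\<dots> \<le> C * norm g" by (rule C)
  also have "\<dots> \<le> C" using \<open>norm g \<le> 1\<close> C(2) by simp
  finally show ?thesis .
qed

text \<open>
  Pigeonhole: each of the first \<open>M\<close> coordinates has total mass at most \<open>C\<close> over a disjoint family of
  bumps, so with more than \<open>M C / e\<close> bumps one of them is small in all these coordinates.
\<close>

lemma small_bump_near_islimpt:
  fixes T :: "('k::topological_space \<Rightarrow>\<^sub>C 'f::real_normed_field) \<Rightarrow> (nat \<Rightarrow>\<^sub>C 'f)"
  assumes tych: "tychonoff_space (euclidean :: 'k topology)"
    and emb: "bcf_embedding T" and C: "\<And>f. norm (T f) \<le> C * norm f" "C > 0"
    and lim: "x islimpt A" and V: "open V" "x \<in> V" and e: "e > 0"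
  obtains f p W where "p \<in> A" "open W" "p \<in> W" "W \<subseteq> V"
    "\<And>y. y \<in> W \<Longrightarrow> apply_bcontfun f y = 1" "\<And>y. y \<notin> V \<Longrightarrow> apply_bcontfun f y = 0"
    "norm f \<le> 1" "\<And>k. k < M \<Longrightarrow> norm (apply_bcontfun (T f) k) < e"
proof -
  obtain J :: nat where J: "real M * C / e < real J"
    using reals_Archimedean2 by blast
  obtain p U where pU: "\<And>j. j < J \<Longrightarrow> p j \<in> A \<and> p j \<in> U j \<and> open (U j) \<and> U j \<subseteq> V"
    and disj: "\<And>i j. i < J \<Longrightarrow> j < J \<Longrightarrow> i \<noteq> j \<Longrightarrow> U i \<inter> U j = {}"
    using disjoint_neighbourhoods_islimpt[OF tych lim V, of J] by metis
  have "\<exists>f W. open W \<and> p j \<in> W \<and> W \<subseteq> U j \<and> (\<forall>y\<in>W. apply_bcontfun f y = (1::'f)) \<and>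
      (\<forall>y. y \<notin> U j \<longrightarrow> apply_bcontfun f y = 0) \<and> (\<forall>y. norm (apply_bcontfun f y) \<le> 1)" if "j < J" for j
    using bcf_plateau[OF tych, of "U j" "p j"] pU[OF that] by metis
  then obtain f W where fW: "\<And>j. j < J \<Longrightarrow> open (W j) \<and> p j \<in> W j \<and> W j \<subseteq> U j \<and>
      (\<forall>y\<in>W j. apply_bcontfun (f j) y = (1::'f)) \<and>
      (\<forall>y. y \<notin> U j \<longrightarrow> apply_bcontfun (f j) y = 0) \<and> (\<forall>y. norm (apply_bcontfun (f j) y) \<le> 1)"
    by metis
  have "\<exists>j<J. \<forall>k<M. norm (apply_bcontfun (T (f j)) k) < e"
  proof (rule ccontr)
    assume "\<not> ?thesis"
    then have large: "\<exists>k<M. e \<le> norm (T (f j) k)" if "j < J" for j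
      using that by (meson not_less)
    have "real J * e = (\<Sum>j<J. e)"
      by simp
    also have "\<dots> \<le> (\<Sum>j<J. \<Sum>k<M. norm (T (f j) k))"
    proof (rule sum_mono)
      fix j assume "j \<in> {..<J}"
      then obtain k where k: "k < M" "e \<le> norm (T (f j) k)" using large by auto
      note k(2)
      also have "norm (T (f j) k) \<le> (\<Sum>k<M. norm (T (f j) k))"
        by (rule member_le_sum) (use k in auto)
      finally show "e \<le> (\<Sum>k<M. norm (T (f j) k))" .
    qed
    also have "\<dots> = (\<Sum>k<M. \<Sum>j<J. norm (T (f j) k))"
      by (rule sum.swap)
    also have "\<dots> \<le> (\<Sum>k<M. C)"
    proof (rule sum_mono)
      fix k
      show "(\<Sum>j<J. norm (T (f j) k)) \<le> C"
      proof (rule sum_coordinates_disjoint_supports[OF emb C])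
        fix i j y assume "i \<in> {..<J}" "j \<in> {..<J}" "i \<noteq> j"
        then have "U i \<inter> U j = {}" "i < J" "j < J" using disj by auto
        then show "f i y = 0 \<or> f j y = 0" using fW by blast
      qed (use fW in auto)
    qed
    also have "\<dots> = real M * C" by simp
    finally show False using J e by (simp add: field_simps)
  qed
  then obtain j where j: "j < J" "\<And>k. k < M \<Longrightarrow> norm (apply_bcontfun (T (f j)) k) < e" by blast
  show thesis
  proof (rule that[of "p j" "W j" "f j"])
    show "norm (f j) \<le> 1"
      by (rule norm_bound) (use fW j in auto)
    show "f j y = 0" if "y \<notin> V" for y
      using fW[OF j(1)] pU[OF j(1)] that by blast
  qed (use fW[OF j(1)] pU[OF j(1)] j(2) in auto)
qed

text \<open>
  Induction on \<open>n\<close>.  Near the point \<open>x\<close> choose a bump \<open>f\<close> whose image is small on the first \<open>M\<close>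
  coordinates; this image is also small from some \<open>N\<close> on.  The induction hypothesis, applied on the
  plateau of \<open>f\<close> and with \<open>max M N\<close> instead of \<open>M\<close>, gives a function \<open>g\<close> whose image is small where
  the image of \<open>f\<close> is large.  Hence the norms of the two images do not add up, but the values of \<open>f\<close>
  and \<open>g\<close> do.
\<close>

lemma tower_of_bumps:
  fixes T :: "('k::topological_space \<Rightarrow>\<^sub>C 'f::real_normed_field) \<Rightarrow> (nat \<Rightarrow>\<^sub>C 'f)"
  assumes tych: "tychonoff_space (euclidean :: 'k topology)"
    and emb: "bcf_embedding T" and ran: "range T \<subseteq> c_null"
    and C: "\<And>f. norm (T f) \<le> C * norm f" "C > 0"
    and "x \<in> cb_derivative n" "open V" "x \<in> V" "e > 0"
  shows "\<exists>g. (\<exists>y\<in>V. apply_bcontfun g y = of_nat n) \<and> norm (T g) \<le> C + e \<and>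
             (\<forall>k<M. norm (apply_bcontfun (T g) k) < e)"
  using assms(6-)
proof (induction n arbitrary: x V e M)
  case 0
  interpret T: bounded_linear T
    by (rule bcf_embeddingE[OF emb])
  show ?case
    using 0 C(2) by (intro exI[of _ 0]) (auto simp: T.zero)
next
  case (Suc n)
  interpret T: bounded_linear T
    by (rule bcf_embeddingE[OF emb])
  have lim: "x islimpt cb_derivative n"
    using Suc.prems(1) by (simp add: cb_derivative_Suc nonisolated_points_islimpt)
  have e2: "e / 2 > 0" using Suc.prems by simp
  obtain f p W where f: "p \<in> cb_derivative n" "open W" "p \<in> W" "W \<subseteq> V"
    "\<And>y. y \<in> W \<Longrightarrow> apply_bcontfun f y = 1" "norm f \<le> 1"
    "\<And>k. k < M \<Longrightarrow> norm (apply_bcontfun (T f) k) < e / 2"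
    using small_bump_near_islimpt[OF tych emb C lim Suc.prems(2,3) e2, of M] by metis
  have "T f \<in> c_null" using ran by blast
  then obtain N where N: "\<And>k. k \<ge> N \<Longrightarrow> norm (apply_bcontfun (T f) k) < e / 2"
    using c_null_eventually_small[OF _ e2] by metis
  obtain g y where y: "y \<in> W" "apply_bcontfun g y = of_nat n" and g: "norm (T g) \<le> C + e / 2"
    and gk: "\<And>k. k < max M N \<Longrightarrow> norm (apply_bcontfun (T g) k) < e / 2"
    using Suc.IH[OF f(1-3) e2, of "max M N"] by blast
  have "norm (T f) \<le> C"
    using C(1)[of f] mult_left_mono[OF f(6), of C] C(2) by linarith
  have tri: "norm (T (f + g) k) \<le> norm (T f k) + norm (T g k)" for k
    by (simp add: T.add norm_triangle_ineq)
  show ?case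
  proof (intro exI[of _ "f + g"] conjI allI impI)
    show "\<exists>y\<in>V. (f + g) y = of_nat (Suc n)"
      using y f(4,5) by (intro bexI[of _ y]) auto
    show "norm (T (f + g)) \<le> C + e"
    proof (rule norm_bound)
      fix k
      show "norm (T (f + g) k) \<le> C + e"
      proof (cases "k < N")
        case True
        then show ?thesis
          using tri[of k] gk[of k] norm_bounded[of "T f" k] \<open>norm (T f) \<le> C\<close> e2 by linarith
      next
        case False
        then show ?thesis
          using tri[of k] N[of k] norm_bounded[of "T g" k] g e2 by simp
      qed
    qed
    fix k assume "k < M"
    then show "norm (T (f + g) k) < e"
      using tri[of k] f(7)[of k] gk[of k] by (simp add: less_max_iff_disj)
  qed
qed

lemma embedding_imp_finite_scattered_height:
  fixes T :: "('k::topological_space \<Rightarrow>\<^sub>C 'f::real_normed_field) \<Rightarrow> (nat \<Rightarrow>\<^sub>C 'f)"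
  assumes tych: "tychonoff_space (euclidean :: 'k topology)"
    and emb: "bcf_embedding T" and ran: "range T \<subseteq> c_null"
  shows "finite_scattered_height TYPE('k)"
proof -
  obtain C where C: "C > 0" "\<And>f. norm (T f) \<le> C * norm f" "\<And>f. norm f \<le> C * norm (T f)"
    using bcf_embeddingE[OF emb] by metis
  obtain n :: nat where n: "C * (C + 1) < real n"
    using reals_Archimedean2 by blast
  have "cb_derivative n = ({} :: 'k set)"
  proof (rule ccontr)
    assume "cb_derivative n \<noteq> ({} :: 'k set)"
    then obtain x :: 'k where "x \<in> cb_derivative n" by blast
    then obtain g y where g: "apply_bcontfun g y = (of_nat n :: 'f)" "norm (T g) \<le> C + 1"
      using tower_of_bumps[OF tych emb ran C(2,1), of x n UNIV 1 0] by auto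
    have "real n \<le> norm g"
      using norm_bounded[of g y] g(1) by simp
    also have "\<dots> \<le> C * norm (T g)" by (rule C)
    also have "\<dots> \<le> C * (C + 1)" using g(2) C(1) by simp
    finally show False using n by simp
  qed
  then show ?thesis
    by (auto simp: finite_scattered_height_def)
qed

section \<open>Countability and compactness\<close>

text \<open>
  Bumps at isolated points of \<open>A\<close> that vanish at the other ones have mutual distance at least \<open>1\<close>.  Hence
  the codes of their images by finite lists over a countable dense set of scalars are distinct.
\<close>

lemma embedding_imp_countable_isolated:
  fixes T :: "('k::topological_space \<Rightarrow>\<^sub>C 'f::{real_normed_field,second_countable_topology}) \<Rightarrow> (nat \<Rightarrow>\<^sub>C 'f)"
  assumes tych: "tychonoff_space (euclidean :: 'k topology)"
    and emb: "bcf_embedding T" and ran: "range T \<subseteq> c_null"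
  shows "countable (A - nonisolated_points A :: 'k set)"
proof -
  obtain C where C: "C > 0" "\<And>f. norm (T f) \<le> C * norm f" "\<And>f. norm f \<le> C * norm (T f)"
      "bounded_linear T"
    using bcf_embeddingE[OF emb] by metis
  interpret T: bounded_linear T by (rule C)
  define I where "I = A - nonisolated_points A"
  have "\<exists>f. apply_bcontfun f x = (1::'f) \<and> (\<forall>y\<in>I - {x}. apply_bcontfun f y = 0)" if x: "x \<in> I" for x
  proof -
    obtain U where U: "open U" "U \<inter> A = {x}"
      using x by (auto simp: I_def nonisolated_points_def elim: isolated_inE)
    then have "x \<in> U" by blast
    then obtain f :: "'k \<Rightarrow>\<^sub>C 'f" and W :: "'k set" where "x \<in> W"
        "\<And>y. y \<in> W \<Longrightarrow> apply_bcontfun f y = 1" "\<And>y. y \<notin> U \<Longrightarrow> apply_bcontfun f y = 0"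
      using bcf_plateau[OF tych U(1), of x] by metis
    moreover have "y \<notin> U" if "y \<in> I - {x}" for y
      using that U(2) by (auto simp: I_def)
    ultimately show ?thesis by blast
  qed
  then obtain f where f: "\<And>x. x \<in> I \<Longrightarrow> apply_bcontfun (f x) x = (1::'f)"
      "\<And>x y. x \<in> I \<Longrightarrow> y \<in> I \<Longrightarrow> x \<noteq> y \<Longrightarrow> apply_bcontfun (f x) y = 0"
    by (metis Diff_iff singletonD)
  obtain G :: "'f set" where G: "countable G" "\<And>U. open U \<Longrightarrow> U \<noteq> {} \<Longrightarrow> \<exists>g\<in>G. g \<in> U"
    using countable_dense_setE by metis
  define \<delta> where "\<delta> = 1 / (4 * C)"
  have \<delta>: "\<delta> > 0" using C by (simp add: \<delta>_def)
  have "\<exists>l\<in>lists G. (\<forall>k<length l. dist (apply_bcontfun (T (f x)) k) (l ! k) < \<delta>) \<and>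
      (\<forall>k\<ge>length l. norm (apply_bcontfun (T (f x)) k) < \<delta>)" for x
  proof -
    have "T (f x) \<in> c_null" using ran by blast
    then obtain M where M: "\<And>k. k \<ge> M \<Longrightarrow> norm (T (f x) k) < \<delta>"
      using c_null_eventually_small[OF _ \<delta>] by metis
    have "\<exists>g\<in>G. dist (T (f x) k) g < \<delta>" for k
      using G(2)[of "ball (T (f x) k) \<delta>"] \<delta> by auto
    then obtain l where "l \<in> lists G" "length l = M" "\<And>k. k < M \<Longrightarrow> dist (T (f x) k) (l ! k) < \<delta>"
      using list_code[where y = "apply_bcontfun (T (f x))" and M = M and G = G and \<delta> = \<delta>] by metis
    with M show ?thesis by metis
  qed
  then obtain l where l: "\<And>x. l x \<in> lists G"
      "\<And>x k. k < length (l x) \<Longrightarrow> dist (apply_bcontfun (T (f x)) k) (l x ! k) < \<delta>"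
      "\<And>x k. k \<ge> length (l x) \<Longrightarrow> norm (apply_bcontfun (T (f x)) k) < \<delta>"
    by metis
  have "inj_on l I"
  proof (rule inj_onI, rule ccontr)
    fix x y assume xy: "x \<in> I" "y \<in> I" "l x = l y" "x \<noteq> y"
    have "dist (T (f x)) (T (f y)) \<le> 2 * \<delta>"
      by (rule dist_le_if_same_code[where M = "length (l x)" and l = "l x"])
        (use l(2,3)[where x = x] l(2,3)[where x = y] xy(3) in auto)
    then have "C * norm (T (f x - f y)) \<le> C * (2 * \<delta>)"
      using C(1) by (intro mult_left_mono) (auto simp: dist_norm T.diff)
    then have "norm (f x - f y) \<le> 1 / 2"
      using C(3)[of "f x - f y"] C(1) by (simp add: \<delta>_def)
    moreover have "norm ((f x - f y) x) = 1"
      using f xy by auto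
    ultimately show False
      using norm_bounded[of "f x - f y" x] by linarith
  qed
  moreover have "countable (l ` I)"
    by (rule countable_subset[OF _ countable_lists[OF G(1)]]) (use l(1) in auto)
  ultimately show ?thesis
    unfolding I_def by (metis countable_image_inj_on)
qed

lemma embedding_imp_countable:
  fixes T :: "('k::topological_space \<Rightarrow>\<^sub>C 'f::{real_normed_field,second_countable_topology}) \<Rightarrow> (nat \<Rightarrow>\<^sub>C 'f)"
  assumes tych: "tychonoff_space (euclidean :: 'k topology)"
    and emb: "bcf_embedding T" and ran: "range T \<subseteq> c_null"
  shows "countable (UNIV :: 'k set)"
proof -
  obtain N where N: "cb_derivative N = ({} :: 'k set)"
    using embedding_imp_finite_scattered_height[OF assms] by (auto simp: finite_scattered_height_def)
  \<comment> \<open>A point that has left the derivatives was isolated in the last one that contained it.\<close>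
  have "- cb_derivative n \<subseteq> (\<Union>m. cb_derivative m - nonisolated_points (cb_derivative m :: 'k set))" for n
  proof (induction n)
    case (Suc n)
    then show ?case unfolding cb_derivative_Suc by blast
  qed (simp add: cb_derivative_0)
  from this[of N] have "(UNIV :: 'k set) \<subseteq> (\<Union>m. cb_derivative m - nonisolated_points (cb_derivative m))"
    using N by simp
  moreover have "countable (\<Union>m. cb_derivative m - nonisolated_points (cb_derivative m :: 'k set))"
    by (intro countable_UN embedding_imp_countable_isolated[OF assms]) auto
  ultimately show ?thesis by (rule countable_subset)
qed

text \<open>
  Subordinate to the countably many chosen members of the cover there is a positive continuous function
  \<open>H = (\<Sum>n. 2\<^sup>-\<^sup>n h\<^sub>n)\<close>.  As \<open>1 / H\<close> is bounded, \<open>H\<close> is bounded away from zero, so a finite partial sum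
  is already positive everywhere.
\<close>

lemma countable_pseudocompact_imp_compact:
  assumes tych: "tychonoff_space (euclidean :: 'k::topological_space topology)"
    and pc: "pseudocompact_space (euclidean :: 'k topology)"
    and count: "countable (UNIV :: 'k set)"
  shows "compact (UNIV :: 'k set)"
proof (rule compactI)
  fix \<U> :: "'k set set"
  assume op: "\<forall>U\<in>\<U>. open U" and cover: "UNIV \<subseteq> \<Union>\<U>"
  define e :: "nat \<Rightarrow> 'k" where "e = from_nat_into UNIV"
  have e: "\<exists>n. e n = x" for x
    using from_nat_into_surj[OF count, of x] by (auto simp: e_def)
  have "\<exists>U. U \<in> \<U> \<and> e n \<in> U" for n
    using cover by blast
  then obtain U where U: "\<And>n. U n \<in> \<U> \<and> e n \<in> U n"
    by metis
  have "\<exists>h::'k \<Rightarrow> real. continuous_on UNIV h \<and> (\<forall>y. 0 \<le> h y \<and> h y \<le> 1) \<and> h (e n) = 1 \<and>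
      (\<forall>y. y \<notin> U n \<longrightarrow> h y = 0)" for n
    using tychonoff_separating_function[OF tych, of "U n" "e n"] U[of n] op by metis
  then obtain h :: "nat \<Rightarrow> 'k \<Rightarrow> real" where h: "\<And>n. continuous_on UNIV (h n)"
      "\<And>n y. 0 \<le> h n y" "\<And>n y. h n y \<le> 1" "\<And>n. h n (e n) = 1" "\<And>n y. y \<notin> U n \<Longrightarrow> h n y = 0"
    by metis
  define H where "H y = (\<Sum>n. (1/2)^n * h n y)" for y
  have geo: "summable (\<lambda>n. (1/2::real)^n)" by simp
  have le: "(1/2)^n * h n y \<le> (1/2)^n" "0 \<le> (1/2)^n * h n y" for n y
    using h(2,3)[of n y] by auto
  have summ: "summable (\<lambda>n. (1/2)^n * h n y)" for y
    by (rule summable_comparison_test'[OF geo]) (use le in auto)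
  have Hpos: "H y > 0" for y
  proof -
    obtain n where "e n = y" using e by blast
    then show ?thesis
      unfolding H_def using le(2) h(4)[of n]
      by (intro suminf_pos2[OF summ, of _ n]) auto
  qed
  have "uniform_limit UNIV (\<lambda>n y. \<Sum>i<n. (1/2)^i * h i y) H sequentially"
    unfolding H_def using le by (intro Weierstrass_m_test[OF _ geo]) auto
  then have contH: "continuous_on UNIV H"
    by (rule uniform_limit_theorem[rotated]) (auto intro!: always_eventually continuous_intros h(1))
  have "continuous_on UNIV (\<lambda>y. 1 / H y)"
    using contH Hpos by (intro continuous_intros) (auto simp: less_imp_neq[symmetric])
  then have "bounded (range (\<lambda>y. 1 / H y))"
    using pc unfolding pseudocompact_space_def by auto
  then obtain b where "b > 0" "\<And>y. \<bar>1 / H y\<bar> \<le> b"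
    unfolding bounded_pos by auto
  then have b: "b > 0" "\<And>y. 1 / H y \<le> b"
    using abs_le_D1 by blast+
  obtain N where N: "(1/2::real)^N < 1 / (2 * b)"
    using real_arch_pow_inv[of "1 / (2 * b)" "1/2"] b by auto
  have "UNIV \<subseteq> \<Union> (U ` {..<N})"
  proof (rule ccontr)
    assume "\<not> ?thesis"
    then obtain y where "\<And>n. n < N \<Longrightarrow> y \<notin> U n" by blast
    then have z: "h n y = 0" if "n < N" for n using h(5) that by blast
    have "H y = (\<Sum>n. (1/2)^(n+N) * h (n+N) y)"
      unfolding H_def using suminf_split_initial_segment[OF summ, of y N] z by simp
    also have "\<dots> \<le> (\<Sum>n. (1/2)^(n+N))"
      using le(1) by (intro suminf_le summable_ignore_initial_segment summ geo) auto
    also have "\<dots> = (1/2)^N * 2"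
      using suminf_mult2[OF geo, of "(1/2)^N"] suminf_geometric[of "1/2::real"] by (simp add: power_add)
    also have "\<dots> < 1 / b"
      using N b by (simp add: field_simps)
    also have "\<dots> \<le> H y"
      using b(1) b(2)[of y] Hpos[of y] by (simp add: field_simps)
    finally show False by simp
  qed
  then show "\<exists>\<U>'\<subseteq>\<U>. finite \<U>' \<and> UNIV \<subseteq> \<Union>\<U>'"
    using U by (intro exI[of _ "U ` {..<N}"]) auto
qed

section \<open>An isomorphism onto the null sequences in finite height\<close>

lemma closed_nonisolated_points:
  assumes "closed A"
  shows "closed (nonisolated_points A)"
proof -
  have "nonisolated_points A = A - \<Union>{T. open T \<and> (\<exists>x. T \<inter> A = {x})}" (is "_ = A - ?I")
  proof -
    have "x isolated_in A \<longleftrightarrow> x \<in> ?I" if "x \<in> A" for x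
    proof
      assume "x isolated_in A"
      then obtain T where "open T" "T \<inter> A = {x}" by (auto simp: isolated_in_def)
      then show "x \<in> ?I" by blast
    next
      assume "x \<in> ?I"
      then obtain T y where T: "open T" "T \<inter> A = {y}" "x \<in> T" by blast
      then have "x = y" using that by blast
      then show "x isolated_in A" using T that by (auto simp: isolated_in_def)
    qed
    then show ?thesis unfolding nonisolated_points_def by blast
  qed
  moreover have "open ?I" by (auto intro: open_Union)
  ultimately show ?thesis
    using assms by (simp add: closed_Diff)
qed

lemma closed_cb_derivative: "closed (cb_derivative n)"
  by (induction n) (simp_all add: cb_derivative_0 cb_derivative_Suc closed_nonisolated_points)

lemma cb_derivative_antimono: "m \<le> n \<Longrightarrow> cb_derivative n \<subseteq> cb_derivative m"
  by (induction rule: dec_induct) (auto simp: cb_derivative_Suc nonisolated_points_def)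

text \<open>
  For each of the countably many pairs of points, one coordinate separates the pair.  On a compact
  space this injection is a homeomorphism onto a subset of a metric space.
\<close>

lemma countable_tychonoff_injection:
  assumes tych: "tychonoff_space (euclidean :: 'k::topological_space topology)"
    and count: "countable (UNIV :: 'k set)"
  obtains \<Phi> :: "'k::topological_space \<Rightarrow> nat \<Rightarrow> real" where "continuous_on UNIV \<Phi>" "inj \<Phi>"
proof -
  define e where "e = from_nat_into (UNIV :: ('k \<times> 'k) set)"
  have "countable (UNIV :: ('k \<times> 'k) set)"
    using countable_SIGMA[OF count, of "\<lambda>_. UNIV"] count by simp
  then have e: "\<exists>n. e n = p" for p
    using from_nat_into_surj[of UNIV p] by (auto simp: e_def)
  have "\<exists>h :: 'k \<Rightarrow> real. continuous_on UNIV h \<and> (fst (e n) \<noteq> snd (e n) \<longrightarrow> h (fst (e n)) \<noteq> h (snd (e n)))" for n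
  proof (cases "fst (e n) = snd (e n)")
    case True
    then show ?thesis by (intro exI[of _ "\<lambda>_. 0"]) auto
  next
    case False
    have "open (- {snd (e n)})"
      by (intro open_Compl tychonoff_closed_singleton[OF tych])
    then obtain h :: "'k \<Rightarrow> real" where "continuous_on UNIV h" "h (fst (e n)) = 1" "h (snd (e n)) = 0"
      using tychonoff_separating_function[OF tych, of "- {snd (e n)}" "fst (e n)"] False
      by (metis ComplI Compl_iff singletonD singletonI)
    then show ?thesis by (intro exI[of _ h]) auto
  qed
  then obtain h :: "nat \<Rightarrow> 'k \<Rightarrow> real" where h: "\<And>n. continuous_on UNIV (h n)"
      "\<And>n. fst (e n) \<noteq> snd (e n) \<Longrightarrow> h n (fst (e n)) \<noteq> h n (snd (e n))"
    by metis
  show thesis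
  proof (rule that[of "\<lambda>x n. h n x"])
    show "continuous_on UNIV (\<lambda>x n. h n x)"
      by (intro continuous_on_coordinatewise_then_product h(1))
    show "inj (\<lambda>x n. h n x)"
    proof (rule injI, rule ccontr)
      fix x y assume eq: "(\<lambda>n. h n x) = (\<lambda>n. h n y)" and "x \<noteq> y"
      obtain n where "e n = (x, y)" using e by blast
      then show False using h(2)[of n] fun_cong[OF eq, of n] \<open>x \<noteq> y\<close> by simp
    qed
  qed
qed

text \<open>
  Each point goes to a nearest non-isolated point, where distances are measured after applying \<open>\<Phi>\<close>.
  Continuity at an isolated point is trivial.  At a non-isolated point \<open>a\<close> the triangle inequality shows
  that points at distance less than \<open>\<eta>/2\<close> are moved to points at distance less than \<open>\<eta>\<close> from \<open>a\<close>.
\<close>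

lemma retraction_onto_nonisolated_points:
  fixes A :: "'k::topological_space set" and \<Phi> :: "'k \<Rightarrow> 'm::metric_space"
  assumes K: "compact (UNIV :: 'k set)" and \<Phi>: "continuous_on UNIV \<Phi>" "inj \<Phi>"
    and A: "closed A" and ne: "nonisolated_points A \<noteq> {}"
  obtains r where "continuous_on A r" "\<And>x. r x \<in> nonisolated_points A"
    "\<And>x. x \<in> nonisolated_points A \<Longrightarrow> r x = x"
proof -
  define B where "B = nonisolated_points A"
  have cpt: "compact S" if "closed S" for S :: "'k set"
    using compact_Int_closed[OF K that] by simp
  have "compact B"
    unfolding B_def by (intro cpt closed_nonisolated_points A)
  have cont: "continuous_on S (\<lambda>y. dist (\<Phi> x) (\<Phi> y))" for x S
    by (intro continuous_intros continuous_on_subset[OF \<Phi>(1)]) auto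
  have "\<exists>b\<in>B. \<forall>y\<in>B. dist (\<Phi> x) (\<Phi> b) \<le> dist (\<Phi> x) (\<Phi> y)" for x
    using \<open>compact B\<close> ne cont by (intro continuous_attains_inf) (auto simp: B_def)
  then obtain r where r: "\<And>x. r x \<in> B" "\<And>x y. y \<in> B \<Longrightarrow> dist (\<Phi> x) (\<Phi> (r x)) \<le> dist (\<Phi> x) (\<Phi> y)"
    by metis
  have rB: "r x = x" if "x \<in> B" for x
    using r(2)[OF that, of x] \<Phi>(2) by (simp add: inj_eq)
  have "continuous_on A r"
    unfolding continuous_on_topological
  proof (intro ballI allI impI)
    fix a V assume a: "a \<in> A" and V: "open V" "r a \<in> V"
    show "\<exists>W. open W \<and> a \<in> W \<and> (\<forall>y\<in>A. y \<in> W \<longrightarrow> r y \<in> V)"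
    proof (cases "a \<in> B")
      case False
      then obtain W where "open W" "W \<inter> A = {a}"
        using a by (auto simp: B_def nonisolated_points_def elim: isolated_inE)
      then show ?thesis using V by (intro exI[of _ W]) auto
    next
      case True
      show ?thesis
      proof (cases "V = UNIV")
        case False
        have "compact (- V)" using V by (intro cpt) (simp add: closed_Compl)
        moreover have "- V \<noteq> {}" using False by blast
        ultimately have "\<exists>z\<in>- V. \<forall>y\<in>- V. dist (\<Phi> a) (\<Phi> z) \<le> dist (\<Phi> a) (\<Phi> y)"
          by (rule continuous_attains_inf[OF _ _ cont])
        then obtain z where z: "z \<notin> V" "\<And>y. y \<notin> V \<Longrightarrow> dist (\<Phi> a) (\<Phi> z) \<le> dist (\<Phi> a) (\<Phi> y)"
          by blast
        \<comment> \<open>The positive distance from \<open>a\<close> to the complement of \<open>V\<close>, attained at \<open>z\<close> by compactness.\<close>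
        define \<eta> where "\<eta> = dist (\<Phi> a) (\<Phi> z)"
        have "a \<noteq> z" using V rB[OF True] z(1) by auto
        then have "\<eta> > 0" using \<Phi>(2) by (simp add: \<eta>_def inj_eq)
        show ?thesis
        proof (intro exI[of _ "{x. dist (\<Phi> a) (\<Phi> x) < \<eta> / 2}"] conjI ballI impI)
          show "open {x. dist (\<Phi> a) (\<Phi> x) < \<eta> / 2}"
            by (intro open_Collect_less cont continuous_intros)
          fix y assume "y \<in> {x. dist (\<Phi> a) (\<Phi> x) < \<eta> / 2}"
          then have y: "dist (\<Phi> a) (\<Phi> y) < \<eta> / 2" by simp
          have "dist (\<Phi> a) (\<Phi> (r y)) \<le> dist (\<Phi> a) (\<Phi> y) + dist (\<Phi> y) (\<Phi> (r y))"
            by (rule dist_triangle)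
          also have "\<dots> \<le> dist (\<Phi> a) (\<Phi> y) + dist (\<Phi> y) (\<Phi> a)"
            using r(2)[OF True, of y] by simp
          also have "\<dots> < \<eta>" using y by (simp add: dist_commute)
          finally show "r y \<in> V"
            using z(2)[of "r y"] unfolding \<eta>_def by linarith
        qed (use \<open>\<eta> > 0\<close> in auto)
      qed (use V in auto)
    qed
  qed
  then show thesis
    using r(1) rB unfolding B_def by (rule that)
qed

text \<open>
  A compact space of finite height together with retractions of each nonempty derivative onto the next
  one, as long as the next one is nonempty.
\<close>

locale cb_retractions =
  fixes N :: nat and r :: "nat \<Rightarrow> 'k::topological_space \<Rightarrow> 'k"
  assumes compact_UNIV: "compact (UNIV :: 'k set)"
    and closed_singleton: "closed {x :: 'k}"
    and height: "cb_derivative N = ({} :: 'k set)"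
    and retraction_continuous: "cb_derivative (Suc m) \<noteq> ({} :: 'k set) \<Longrightarrow> continuous_on (cb_derivative m) (r m)"
    and retraction_range: "cb_derivative (Suc m) \<noteq> ({} :: 'k set) \<Longrightarrow> r m x \<in> cb_derivative (Suc m)"
    and retraction_id: "x \<in> cb_derivative (Suc m) \<Longrightarrow> r m x = x"
begin

definition cb_rank :: "'k \<Rightarrow> nat" where
  "cb_rank x = (LEAST m. x \<notin> cb_derivative (Suc m))"

text \<open>
  The isolated points of the last nonempty derivative have no point to be retracted to; there the value
  \<open>0\<close> is subtracted in \<open>difference\<close>, so that \<open>difference f\<close> agrees with \<open>f\<close>.
\<close>

definition pullback :: "nat \<Rightarrow> ('k \<Rightarrow> 'f::real_normed_field) \<Rightarrow> 'k \<Rightarrow> 'f" where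
  "pullback m f x = (if cb_derivative (Suc m) = ({} :: 'k set) then 0 else f (r m x))"

definition difference :: "('k \<Rightarrow> 'f::real_normed_field) \<Rightarrow> 'k \<Rightarrow> 'f" where
  "difference f x = f x - pullback (cb_rank x) f x"

lemma cb_rank_eqI:
  assumes "x \<in> cb_derivative m" "x \<notin> cb_derivative (Suc m)"
  shows "cb_rank x = m"
  unfolding cb_rank_def
proof (rule Least_equality)
  show "m \<le> n" if "x \<notin> cb_derivative (Suc n)" for n
    using that assms(1) cb_derivative_antimono[of "Suc n" m] by (meson not_less_eq_eq subsetD)
qed (rule assms)

lemma in_cb_derivative_rank: "x \<in> cb_derivative (cb_rank x)"
  and not_in_cb_derivative_Suc_rank: "x \<notin> cb_derivative (Suc (cb_rank x))"
  and cb_rank_less: "cb_rank x < N"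
proof -
  have "x \<notin> cb_derivative (Suc N)"
    using height cb_derivative_antimono[of N "Suc N"] by auto
  then show not: "x \<notin> cb_derivative (Suc (cb_rank x))"
    unfolding cb_rank_def by (rule LeastI)
  show "in": "x \<in> cb_derivative (cb_rank x)"
  proof (cases "cb_rank x")
    case (Suc m)
    then have "m < (LEAST m. x \<notin> cb_derivative (Suc m))" by (simp add: cb_rank_def)
    from not_less_Least[OF this] show ?thesis by (simp add: Suc)
  qed (simp add: cb_derivative_0)
  show "cb_rank x < N"
  proof (rule ccontr)
    assume "\<not> cb_rank x < N"
    then have "cb_derivative (cb_rank x) \<subseteq> ({} :: 'k set)"
      using cb_derivative_antimono[of N "cb_rank x"] height by (metis not_less)
    with "in" show False by blast
  qed
qed

lemma continuous_on_pullback: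
  assumes "continuous_on (cb_derivative (Suc m)) f"
  shows "continuous_on (cb_derivative m) (pullback m f)"
proof (cases "cb_derivative (Suc m) = ({} :: 'k set)")
  case False
  then show ?thesis
    using continuous_on_compose2[OF assms retraction_continuous] retraction_range[OF False]
    unfolding pullback_def by auto
qed (simp add: pullback_def)

text \<open>
  On the \<open>m\<close>-th derivative the function \<open>f - pullback m f\<close> is continuous and vanishes at the
  non-isolated points.  The set where it is large is thus compact and consists of isolated points.
\<close>

lemma finite_difference_ge:
  fixes f :: "'k \<Rightarrow> 'f::real_normed_field"
  assumes f: "continuous_on UNIV f" and e: "e > 0"
  shows "finite {x. norm (difference f x) \<ge> e}"
proof -
  have "finite {x \<in> cb_derivative m. e \<le> norm (f x - pullback m f x)}" (is "finite ?S") for m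
  proof (rule ccontr)
    assume inf: "infinite ?S"
    have "continuous_on (cb_derivative m) (\<lambda>x. norm (f x - pullback m f x))"
      by (intro continuous_intros continuous_on_pullback continuous_on_subset[OF f]) auto
    then have "closed ?S"
      using continuous_closed_preimage[OF _ closed_cb_derivative, of m _ "{e..}"]
      by (simp add: vimage_def Int_def)
    then have "compact ?S"
      using compact_Int_closed[OF compact_UNIV] by simp
    then obtain z where z: "z \<in> ?S" "z islimpt ?S"
      using Heine_Borel_imp_Bolzano_Weierstrass[OF _ inf order_refl] by blast
    then have "z islimpt cb_derivative m"
      using islimpt_subset[of z ?S] by blast
    then have "z \<in> cb_derivative (Suc m)"
      using z(1) by (simp add: cb_derivative_Suc nonisolated_points_islimpt)
    then have "pullback m f z = f z"
      by (auto simp: pullback_def retraction_id)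
    then show False using z(1) e by simp
  qed
  then have "finite (\<Union>m<N. {x \<in> cb_derivative m. e \<le> norm (f x - pullback m f x)})"
    by blast
  moreover have "{x. norm (difference f x) \<ge> e} \<subseteq>
      (\<Union>m<N. {x \<in> cb_derivative m. e \<le> norm (f x - pullback m f x)})"
    using cb_rank_less in_cb_derivative_rank by (auto simp: difference_def)
  ultimately show ?thesis by (rule finite_subset[rotated])
qed

text \<open>
  Retracting raises the rank, so \<open>f(x)\<close> is a telescoping sum of at most \<open>N\<close> differences.  The
  induction runs over the derivatives, starting with the empty one.
\<close>

lemma norm_le_difference:
  fixes f :: "'k \<Rightarrow> 'f::real_normed_field"
  assumes s: "\<And>x. norm (difference f x) \<le> s"
  shows "norm (f x) \<le> real N * s"
proof -
  have s0: "s \<ge> 0"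
    using s[of undefined] norm_ge_zero order_trans by blast
  have "\<forall>x\<in>cb_derivative m. norm (f x) \<le> real k * s" if "N \<le> m + k" for m k
    using that
  proof (induction k arbitrary: m)
    case 0
    then show ?case
      using cb_derivative_antimono[of N m] height by auto
  next
    case (Suc k)
    have IH: "norm (f y) \<le> real k * s" if "y \<in> cb_derivative (Suc m)" for y
      using Suc.IH[of "Suc m"] Suc.prems that by simp
    show ?case
    proof
      fix x :: 'k assume x: "x \<in> cb_derivative m"
      show "norm (f x) \<le> real (Suc k) * s"
      proof (cases "x \<in> cb_derivative (Suc m)")
        case True
        then show ?thesis using IH[OF True] s0 by (simp add: distrib_right)
      next
        case False
        then have "f x = difference f x + pullback m f x"
          using cb_rank_eqI[OF x False] by (simp add: difference_def)
        moreover have "norm (pullback m f x) \<le> real k * s"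
          using IH retraction_range[of m x] s0 by (auto simp: pullback_def)
        ultimately show ?thesis
          using norm_triangle_ineq[of "difference f x" "pullback m f x"] s[of x] by (simp add: distrib_right)
      qed
    qed
  qed
  from this[of 0 N] show ?thesis by (simp add: cb_derivative_0)
qed

text \<open>
  A function tends to zero at a non-isolated point if it is large at finitely many points only, because
  these can be removed from a neighbourhood.
\<close>

lemma continuous_on_vanishing_on_nonisolated:
  fixes y :: "'k \<Rightarrow> 'f::real_normed_field" and A :: "'k set"
  assumes fin: "\<And>e. e > 0 \<Longrightarrow> finite {x. norm (y x) \<ge> e}"
  shows "continuous_on A (\<lambda>x. if x \<in> nonisolated_points A then 0 else y x)"
    (is "continuous_on A ?g")
  unfolding continuous_on_def
proof
  fix a assume a: "a \<in> A"
  show "(?g \<longlongrightarrow> ?g a) (at a within A)"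
  proof (cases "a \<in> nonisolated_points A")
    case True
    have "(?g \<longlongrightarrow> 0) (at a within A)"
    proof (rule tendstoI)
      fix e :: real assume e: "e > 0"
      define F where "F = {x. norm (y x) \<ge> e} - {a}"
      have "F = (\<Union>x\<in>F. {x})" by simp
      moreover have "closed (\<Union>x\<in>F. {x})"
        using fin[OF e] closed_singleton by (intro closed_UN) (auto simp: F_def)
      ultimately have "open (- F)" by (simp add: open_Compl)
      then show "\<forall>\<^sub>F x in at a within A. dist (?g x) 0 < e"
        unfolding eventually_at_topological
        using e by (intro exI[of _ "- F"]) (auto simp: F_def not_le)
    qed
    then show ?thesis using True by simp
  next
    case False
    then have "\<not> a islimpt A"
      using a by (simp add: nonisolated_points_islimpt)
    then have "at a within A = bot"
      by (simp add: trivial_limit_within)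
    then show ?thesis by simp
  qed
qed

text \<open>
  The equation \<open>difference f = y\<close> is solved on one derivative after the other, beginning with the
  smallest: a solution \<open>g\<close> on the next derivative is extended by \<open>pullback m g + y\<close>.
\<close>

lemma difference_surjective:
  fixes y :: "'k \<Rightarrow> 'f::real_normed_field"
  assumes fin: "\<And>e. e > 0 \<Longrightarrow> finite {x. norm (y x) \<ge> e}"
  obtains f where "continuous_on UNIV f" "\<And>x. difference f x = y x"
proof -
  have "\<exists>f. continuous_on (cb_derivative m) f \<and> (\<forall>x\<in>cb_derivative m. difference f x = y x)"
    if "N \<le> m + k" for m k
    using that
  proof (induction k arbitrary: m)
    case 0
    then have "cb_derivative m = ({} :: 'k set)"
      using cb_derivative_antimono[of N m] height by auto
    then show ?case by simp
  next
    case (Suc k)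
    obtain g where g: "continuous_on (cb_derivative (Suc m)) g"
        "\<And>x. x \<in> cb_derivative (Suc m) \<Longrightarrow> difference g x = y x"
      using Suc.IH[of "Suc m"] Suc.prems by auto
    define f where "f x = pullback m g x + (if x \<in> nonisolated_points (cb_derivative m) then 0 else y x)" for x
    have fg: "f x = g x" if "x \<in> cb_derivative (Suc m)" for x
      using that retraction_id[OF that] by (auto simp: f_def pullback_def cb_derivative_Suc)
    \<comment> \<open>Retracted points lie in the next derivative, where \<open>f\<close> and \<open>g\<close> agree.\<close>
    have pull: "pullback n f x = pullback n g x" if "m \<le> n" for n x
      using retraction_range[of n x] cb_derivative_antimono[of "Suc m" "Suc n"] that fg
      by (auto simp: pullback_def)
    have "continuous_on (cb_derivative m) f"
      unfolding f_def
      by (intro continuous_intros continuous_on_pullback g(1) continuous_on_vanishing_on_nonisolated fin)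
    moreover have "difference f x = y x" if x: "x \<in> cb_derivative m" for x
    proof (cases "x \<in> cb_derivative (Suc m)")
      case True
      have "Suc m \<le> cb_rank x"
      proof (rule ccontr)
        assume "\<not> Suc m \<le> cb_rank x"
        then have "Suc (cb_rank x) \<le> Suc m" by simp
        then show False
          using cb_derivative_antimono not_in_cb_derivative_Suc_rank[of x] True by blast
      qed
      then show ?thesis
        using g(2)[OF True] fg[OF True] pull[of "cb_rank x" x] by (simp add: difference_def)
    next
      case False
      then show ?thesis
        using pull[of m x] cb_rank_eqI[OF x False]
        by (simp add: difference_def) (simp add: f_def cb_derivative_Suc)
    qed
    ultimately show ?case by blast
  qed
  from this[of 0 N] show thesis
    using that by (auto simp: cb_derivative_0)
qed

lemma embedding_onto_c_null:
  assumes "countable (UNIV :: 'k set)" "infinite (UNIV :: 'k set)"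
  obtains T :: "('k \<Rightarrow>\<^sub>C 'f::real_normed_field) \<Rightarrow> (nat \<Rightarrow>\<^sub>C 'f)" where
    "bcf_embedding T" "range T = c_null"
proof -
  define e where "e = from_nat_into (UNIV :: 'k set)"
  have e: "bij e"
    unfolding e_def by (rule bij_betw_from_nat_into[OF assms])
  have null: "(\<lambda>n. difference (apply_bcontfun f) (e n)) \<longlonglongrightarrow> 0" for f :: "'k \<Rightarrow>\<^sub>C 'f"
  proof (rule tendstoI)
    fix \<epsilon> :: real assume \<epsilon>: "\<epsilon> > 0"
    have "finite (e -` {x. norm (difference f x) \<ge> \<epsilon>})"
      using finite_difference_ge[OF _ \<epsilon>, of f] bij_is_inj[OF e] by (intro finite_vimageI) auto
    then have "\<forall>\<^sub>F n in cofinite. \<not> norm (difference f (e n)) \<ge> \<epsilon>"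
      by (simp add: eventually_cofinite vimage_def)
    then show "\<forall>\<^sub>F n in sequentially. dist (difference f (e n)) 0 < \<epsilon>"
      by (simp add: cofinite_eq_sequentially not_le)
  qed
  then have "\<exists>z\<in>c_null. \<forall>n. apply_bcontfun z n = difference (apply_bcontfun f) (e n)" for f :: "'k \<Rightarrow>\<^sub>C 'f"
    using c_null_bcontfunI[OF null[of f]] by metis
  then obtain T where T: "\<And>f :: 'k \<Rightarrow>\<^sub>C 'f. T f \<in> c_null"
      "\<And>(f :: 'k \<Rightarrow>\<^sub>C 'f) n. apply_bcontfun (T f) n = difference (apply_bcontfun f) (e n)"
    by metis
  have "bcf_embedding T"
  proof (rule bcf_embeddingI)
    show "T (f + g) = T f + T g" for f g
      by (rule bcontfun_eqI) (simp add: T difference_def pullback_def)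
    show "T (bcf_scale c f) = bcf_scale c (T f)" for c f
      by (rule bcontfun_eqI) (simp add: T difference_def pullback_def algebra_simps)
    show "norm (T f) \<le> 2 * norm f" for f
    proof (rule norm_bound)
      fix n
      have "norm (pullback m f x) \<le> norm f" for m x
        by (simp add: pullback_def norm_bounded)
      then show "norm (T f n) \<le> 2 * norm f"
        using norm_triangle_ineq4[of "f (e n)" "pullback (cb_rank (e n)) f (e n)"]
          norm_bounded[of f "e n"]
        by (simp add: T difference_def) (smt (verit))
    qed
    show "norm f \<le> real N * norm (T f)" for f
    proof (rule norm_bound, rule norm_le_difference)
      fix x
      obtain n where "x = e n" using e by (metis bij_pointE)
      then show "norm (difference f x) \<le> norm (T f)"
        using norm_bounded[of "T f" n] by (simp add: T)
    qed
  qed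
  moreover have "z \<in> range T" if z: "z \<in> c_null" for z :: "nat \<Rightarrow>\<^sub>C 'f"
  proof -
    define y where "y x = z (inv e x)" for x
    have fin: "finite {x. norm (y x) \<ge> \<epsilon>}" if \<epsilon>: "\<epsilon> > 0" for \<epsilon>
    proof -
      obtain M where M: "\<And>k. k \<ge> M \<Longrightarrow> norm (z k) < \<epsilon>"
        using c_null_eventually_small[OF z \<epsilon>] by metis
      have "{x. norm (y x) \<ge> \<epsilon>} \<subseteq> e ` {..<M}"
      proof
        fix x assume "x \<in> {x. norm (y x) \<ge> \<epsilon>}"
        then have "inv e x < M"
          using M[of "inv e x"] by (force simp: y_def)
        moreover have "x = e (inv e x)"
          using e by (simp add: bij_is_surj surj_f_inv_f)
        ultimately show "x \<in> e ` {..<M}" by blast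
      qed
      then show ?thesis by (rule finite_subset) simp
    qed
    obtain f where f: "continuous_on UNIV f" "\<And>x. difference f x = y x"
      using difference_surjective[OF fin] by metis
    have "compact (range f)"
      using f(1) compact_UNIV by (rule compact_continuous_image)
    then have "f \<in> bcontfun"
      using f(1) by (simp add: bcontfun_def compact_imp_bounded)
    then obtain F where F: "f = apply_bcontfun F" by (rule bcontfunE)
    have "T F = z"
      by (rule bcontfun_eqI) (simp add: T flip: F, simp add: f(2) y_def bij_is_inj[OF e])
    then show ?thesis by blast
  qed
  ultimately show thesis
    using T(1) by (intro that[of T]) auto
qed

end

lemma finite_height_imp_embedding_onto_c_null:
  assumes tych: "tychonoff_space (euclidean :: 'k::topological_space topology)"
    and K: "compact (UNIV :: 'k set)" "countable (UNIV :: 'k set)" "infinite (UNIV :: 'k set)"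
    and height: "finite_scattered_height TYPE('k)"
  obtains T :: "('k::topological_space \<Rightarrow>\<^sub>C 'f::real_normed_field) \<Rightarrow> (nat \<Rightarrow>\<^sub>C 'f)" where
    "bcf_embedding T" "range T = c_null"
proof -
  obtain N where N: "cb_derivative N = ({} :: 'k set)"
    using height by (auto simp: finite_scattered_height_def)
  obtain \<Phi> :: "'k \<Rightarrow> nat \<Rightarrow> real" where \<Phi>: "continuous_on UNIV \<Phi>" "inj \<Phi>"
    using countable_tychonoff_injection[OF tych K(2)] .
  have "\<exists>r :: 'k \<Rightarrow> 'k. cb_derivative (Suc m) \<noteq> ({} :: 'k set) \<longrightarrow>
      continuous_on (cb_derivative m) r \<and> (\<forall>x. r x \<in> cb_derivative (Suc m)) \<and>
      (\<forall>x\<in>cb_derivative (Suc m). r x = x)" for m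
    using retraction_onto_nonisolated_points[OF K(1) \<Phi> closed_cb_derivative[of m]]
    unfolding cb_derivative_Suc by metis
  then obtain r :: "nat \<Rightarrow> 'k \<Rightarrow> 'k" where r: "\<And>m. cb_derivative (Suc m) \<noteq> ({} :: 'k set) \<Longrightarrow>
      continuous_on (cb_derivative m) (r m) \<and> (\<forall>x. r m x \<in> cb_derivative (Suc m)) \<and>
      (\<forall>x\<in>cb_derivative (Suc m). r m x = x)"
    by metis
  interpret cb_retractions N r
  proof
    show "closed {x}" for x :: 'k by (rule tychonoff_closed_singleton[OF tych])
    show "r m x = x" if "x \<in> cb_derivative (Suc m)" for x m
      using r[of m] that by blast
  qed (use K(1) N r in simp_all)
  show thesis
    using embedding_onto_c_null[OF K(2,3)] that by metis
qed

section \<open>The equivalences\<close>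

lemma strongly_gelfand_phillips_bcf_equivalences:
  assumes inf: "infinite (UNIV :: 'k::topological_space set)"
    and tych: "tychonoff_space (euclidean :: 'k topology)"
    and pc: "pseudocompact_space (euclidean :: 'k topology)"
  defines "smul \<equiv> bcf_scale :: 'f::{real_normed_field,euclidean_space} \<Rightarrow> ('k \<Rightarrow>\<^sub>C 'f) \<Rightarrow> _"
  shows "(strongly_gelfand_phillips smul
        \<longleftrightarrow> (\<exists>S \<subseteq> c_null. isomorphic_subspaces smul UNIV bcf_scale S)) \<and>
      ((\<exists>S \<subseteq> c_null. isomorphic_subspaces smul UNIV bcf_scale S)
        \<longleftrightarrow> compact (UNIV :: 'k set) \<and> countable (UNIV :: 'k set) \<and>
            isomorphic_subspaces smul UNIV bcf_scale c_null) \<and>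
      (compact (UNIV :: 'k set) \<and> countable (UNIV :: 'k set) \<and>
            isomorphic_subspaces smul UNIV bcf_scale c_null
        \<longleftrightarrow> compact (UNIV :: 'k set) \<and> countable (UNIV :: 'k set) \<and>
            finite_scattered_height TYPE('k))" (is "(?i \<longleftrightarrow> ?ii) \<and> (_ \<longleftrightarrow> ?iii) \<and> (_ \<longleftrightarrow> ?iv)")
proof -
  have iso: "isomorphic_subspaces smul UNIV bcf_scale S \<longleftrightarrow>
      (\<exists>T :: ('k \<Rightarrow>\<^sub>C 'f) \<Rightarrow> _. bcf_embedding T \<and> range T = S)" for S :: "(nat \<Rightarrow>\<^sub>C 'f) set"
    unfolding smul_def by (rule isomorphic_subspaces_bcf_iff)
  have ii: "?ii \<longleftrightarrow> (\<exists>T :: ('k \<Rightarrow>\<^sub>C 'f) \<Rightarrow> _. bcf_embedding T \<and> range T \<subseteq> c_null)"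
    unfolding iso by blast
  have "?ii" if ?i
    using strongly_gelfand_phillips_imp_embedding[OF that[unfolded smul_def]] unfolding ii by metis
  moreover have "?i \<and> ?iv" if ?ii
  proof -
    obtain T :: "('k \<Rightarrow>\<^sub>C 'f) \<Rightarrow> (nat \<Rightarrow>\<^sub>C 'f)" where T: "bcf_embedding T" "range T \<subseteq> c_null"
      using \<open>?ii\<close> unfolding ii by blast
    have "countable (UNIV :: 'k set)"
      by (rule embedding_imp_countable[OF tych T])
    then show ?thesis
      using embedding_imp_strongly_gelfand_phillips[OF T] embedding_imp_finite_scattered_height[OF tych T]
        countable_pseudocompact_imp_compact[OF tych pc] by (simp add: smul_def)
  qed
  moreover have "?iii" if ?iv
  proof -
    have K: "compact (UNIV :: 'k set)" "countable (UNIV :: 'k set)" "finite_scattered_height TYPE('k)"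
      using that by simp_all
    obtain T :: "('k \<Rightarrow>\<^sub>C 'f) \<Rightarrow> (nat \<Rightarrow>\<^sub>C 'f)" where T: "bcf_embedding T" "range T = c_null"
      by (rule finite_height_imp_embedding_onto_c_null[OF tych K(1,2) inf K(3)])
    then show ?thesis
      using that unfolding iso by blast
  qed
  moreover have "?ii" if ?iii
    using that by blast
  ultimately show ?thesis by argo
qed

theorem theorem3p4:
  assumes "infinite (UNIV :: 'k::topological_space set)"
    and "tychonoff_space (euclidean :: 'k topology)"
    and "pseudocompact_space (euclidean :: 'k topology)"
  shows
    "((strongly_gelfand_phillips (bcf_scale :: real \<Rightarrow> ('k \<Rightarrow>\<^sub>C real) \<Rightarrow> _)
        \<longleftrightarrow> (\<exists>S \<subseteq> c_null. isomorphic_subspaces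
               (bcf_scale :: real \<Rightarrow> ('k \<Rightarrow>\<^sub>C real) \<Rightarrow> _) UNIV bcf_scale S)) \<and>
      ((\<exists>S \<subseteq> c_null. isomorphic_subspaces
               (bcf_scale :: real \<Rightarrow> ('k \<Rightarrow>\<^sub>C real) \<Rightarrow> _) UNIV bcf_scale S)
        \<longleftrightarrow> compact (UNIV :: 'k set) \<and> countable (UNIV :: 'k set) \<and>
            isomorphic_subspaces
               (bcf_scale :: real \<Rightarrow> ('k \<Rightarrow>\<^sub>C real) \<Rightarrow> _) UNIV bcf_scale c_null) \<and>
      (compact (UNIV :: 'k set) \<and> countable (UNIV :: 'k set) \<and>
            isomorphic_subspaces
               (bcf_scale :: real \<Rightarrow> ('k \<Rightarrow>\<^sub>C real) \<Rightarrow> _) UNIV bcf_scale c_null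
        \<longleftrightarrow> compact (UNIV :: 'k set) \<and> countable (UNIV :: 'k set) \<and>
            finite_scattered_height TYPE('k)))
     \<and>
     ((strongly_gelfand_phillips (bcf_scale :: complex \<Rightarrow> ('k \<Rightarrow>\<^sub>C complex) \<Rightarrow> _)
        \<longleftrightarrow> (\<exists>S \<subseteq> c_null. isomorphic_subspaces
               (bcf_scale :: complex \<Rightarrow> ('k \<Rightarrow>\<^sub>C complex) \<Rightarrow> _) UNIV bcf_scale S)) \<and>
      ((\<exists>S \<subseteq> c_null. isomorphic_subspaces
               (bcf_scale :: complex \<Rightarrow> ('k \<Rightarrow>\<^sub>C complex) \<Rightarrow> _) UNIV bcf_scale S)
        \<longleftrightarrow> compact (UNIV :: 'k set) \<and> countable (UNIV :: 'k set) \<and>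
            isomorphic_subspaces
               (bcf_scale :: complex \<Rightarrow> ('k \<Rightarrow>\<^sub>C complex) \<Rightarrow> _) UNIV bcf_scale c_null) \<and>
      (compact (UNIV :: 'k set) \<and> countable (UNIV :: 'k set) \<and>
            isomorphic_subspaces
               (bcf_scale :: complex \<Rightarrow> ('k \<Rightarrow>\<^sub>C complex) \<Rightarrow> _) UNIV bcf_scale c_null
        \<longleftrightarrow> compact (UNIV :: 'k set) \<and> countable (UNIV :: 'k set) \<and>
            finite_scattered_height TYPE('k)))"
  using strongly_gelfand_phillips_bcf_equivalences[where 'f = real, OF assms]
    strongly_gelfand_phillips_bcf_equivalences[where 'f = complex, OF assms]
  by (rule conjI)

end
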